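(* Let $n\ge 3$ and let $\mathbf X_1,\dots,\mathbf X_n$ be independent standard normal random vectors in $\mathbb R^{n-2}$. Almost surely these points are in general position and hence admit a unique Radon partition $\{\mathcal A_n,\mathcal B_n\}$ (a partition of $\{\mathbf X_1,\dots,\mathbf X_n\}$ into two sets whose convex hulls intersect). Let $\mathcal S_n$ be one of the two parts $\mathcal A_n,\mathcal B_n$, chosen uniformly at random (independently), and for $0\le k\le n$ let $p_k=\mathbb P[|\mathcal S_n|=k]$. Then the sequence $(p_0,\dots,p_n)$ is ultra log-concave, i.e. \[ \left(\frac{p_k}{\binom nk}\right)^2\ \ge\ \frac{p_{k+1}}{\binom{n}{k+1}}\cdot\frac{p_{k-1}}{\binom{n}{k-1}} \] for every $k\in\{1,\dots,n-1\}$.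
   Context: A Radon partition of a finite set $X\subset\mathbb R^d$ is a partition of $X$ into two sets whose convex hulls intersect; by Radon's theorem, $n$ points of $\mathbb R^{n-2}$ in general position have exactly one such partition. *)

theory Defs
  imports "HOL-Probability.Probability"
begin

text \<open>Density of \<open>N(0, I)\<close> on \<open>real ^ 'd\<close> with respect to Lebesgue measure.\<close>

definition std_normal_vec_density :: "real ^ 'd \<Rightarrow> real" where
  "std_normal_vec_density x = (\<Prod>j\<in>UNIV. std_normal_density (x $ j))"

definition general_position :: "('a::euclidean_space) set \<Rightarrow> bool" where
  "general_position P \<longleftrightarrow>
     (\<forall>T\<subseteq>P. finite T \<and> card T \<le> DIM('a) + 1 \<longrightarrow> \<not> affine_dependent T)"

text \<open>Unordered partitions of \<open>P\<close> into two parts. Since the hulls have a common point,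
  both parts are nonempty, and, being disjoint, they are distinct.\<close>

definition radon_partition :: "('a::real_vector) set \<Rightarrow> 'a set set \<Rightarrow> bool" where
  "radon_partition P Q \<longleftrightarrow>
     (\<exists>A B. Q = {A, B} \<and> A \<union> B = P \<and> A \<inter> B = {} \<and> convex hull A \<inter> convex hull B \<noteq> {})"

text \<open>The random variables \<open>Y\<close> and \<open>Z\<close> are independent; they may have values in different types,
  which \<open>prob_space.indep_var\<close> does not allow.\<close>

definition indep_rv ::
  "'w measure \<Rightarrow> 'b measure \<Rightarrow> ('w \<Rightarrow> 'b) \<Rightarrow> 'c measure \<Rightarrow> ('w \<Rightarrow> 'c) \<Rightarrow> bool" where
  "indep_rv M N Y K Z \<longleftrightarrow> Y \<in> measurable M N \<and> Z \<in> measurable M K \<and>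
     prob_space.indep_set M {Y -` U \<inter> space M | U. U \<in> sets N} {Z -` V \<inter> space M | V. V \<in> sets K}"

text \<open>\<open>S\<close> is one of the two parts of the Radon partition of \<open>X 0, \<dots>, X (n - 1)\<close>, selected by a
  fair coin \<open>C\<close>. The two parts are named by a random index set \<open>I\<close>: one consists of the points
  with index in \<open>I\<close>, the other of the remaining points. The naming is arbitrary, but it is
  measurable and the coin is independent of the points and of the naming jointly.\<close>

definition uniform_radon_part ::
  "'w measure \<Rightarrow> nat \<Rightarrow> (nat \<Rightarrow> 'w \<Rightarrow> 'v::euclidean_space) \<Rightarrow> ('w \<Rightarrow> 'v set) \<Rightarrow> bool" where
  "uniform_radon_part M n X S \<longleftrightarrow>
     (\<exists>(I :: 'w \<Rightarrow> nat set) (A :: 'w \<Rightarrow> 'v set) (B :: 'w \<Rightarrow> 'v set) (C :: 'w \<Rightarrow> bool).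
        (\<forall>\<omega>. A \<omega> = (\<lambda>i. X i \<omega>) ` I \<omega> \<and> B \<omega> = (\<lambda>i. X i \<omega>) ` ({..<n} - I \<omega>)) \<and>
        (AE \<omega> in M. radon_partition ((\<lambda>i. X i \<omega>) ` {..<n}) {A \<omega>, B \<omega>}) \<and>
        measure M {\<omega> \<in> space M. C \<omega>} = 1 / 2 \<and>
        indep_rv M
          (count_space UNIV) C
          (PiM {..<n} (\<lambda>_. borel) \<Otimes>\<^sub>M count_space (Pow {..<n})) (\<lambda>\<omega>. (\<lambda>i\<in>{..<n}. X i \<omega>, I \<omega>)) \<and>
        S = (\<lambda>\<omega>. if C \<omega> then A \<omega> else B \<omega>))"

definition ultra_log_concave :: "nat \<Rightarrow> (nat \<Rightarrow> real) \<Rightarrow> bool" where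
  "ultra_log_concave n p \<longleftrightarrow>
     (\<forall>k\<in>{1..n - 1}.
        (p k / real (n choose k))\<^sup>2
          \<ge> (p (k + 1) / real (n choose (k + 1))) * (p (k - 1) / real (n choose (k - 1))))"

end

theory Submission
  imports Defs
begin

text \<open>
  The affine dependence \<open>\<lambda>\<close> of the \<open>n\<close> points is unique up to a factor, and the Radon partition
  separates its positive from its negative entries. Here \<open>\<lambda>\<close> spans the orthogonal complement in
  \<open>\<real>\<^sup>n\<close> of the vector \<open>1\<close> and of \<open>n - 2\<close> independent Gaussian vectors (the coordinates of the
  points), so the law of its line is invariant under the isometries that fix \<open>1\<close>. A law on the lines
  of \<open>1\<^sup>\<bottom>\<close> with this invariance is unique, hence \<open>\<lambda>\<close> may be replaced by \<open>g - mean g\<close> with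
  \<open>g\<close> Gaussian in \<open>\<real>\<^sup>n\<close>. Therefore \<open>p k / (n choose k)\<close> is the probability \<open>q k\<close> that exactly the
  first \<open>k\<close> entries of \<open>g\<close> exceed their mean.

  Conditioning on the mean, \<open>q k\<close> is up to a constant the integral of a product of densities
  \<open>f\<^sub>+\<close>, \<open>f\<^sub>-\<close> (the two halves of the normal density) over the hyperplane where the entries add up to
  \<open>0\<close>. Fix the signs of all but two entries \<open>x\<close>, \<open>y\<close> and integrate the others out: this gives
  \<open>f\<^sub>\<plusminus> x * f\<^sub>\<plusminus> y * w (- x - y)\<close> where \<open>w\<close>, as a convolution of log-concave functions, is log-concave.
  For \<open>x, y > 0 > x', y'\<close> this yields \<open>w (- x - y) * w (- x' - y') \<le> w (- x - y') * w (- x' - y)\<close>, and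
  integration gives \<open>q (k + 1) * q (k - 1) \<le> (q k)\<^sup>2\<close>.
\<close>

section \<open>The standard Gaussian measure\<close>

text \<open>Only the line of the dependence is canonical, not its sign: the cofactor vector
  \<open>dep\<close> even changes sign under reflections. The fair coin fits this, since it replaces
  the number of positive entries by an average over the two signs, that is, by a quantity of the
  line. Hence it suffices to compare open sets stable under all nonzero factors, and invariance is
  tested only on symmetric caps, by reflections fixing \<open>1\<close>. For \<open>g\<close> the
  two signs are equally likely, so the coin's factor \<open>1 / 2\<close> is compensated. The
  constant in the formula for \<open>q k\<close> comes from the independence of the mean of
  \<open>g\<close> and the deviations from it: the density of the mean splits off and does not see
  the sign pattern. The inequality for \<open>q\<close> is an exchange: among the four sign patterns
  that agree outside two entries, two have \<open>k\<close> positive entries and one each has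
  \<open>k - 1\<close> and \<open>k + 1\<close>. A third entry, determined by the others through the
  sum \<open>0\<close>, turns the constraint into the function \<open>w\<close>; it exists because
  \<open>n \<ge> 3\<close>.\<close>

text \<open>The image \<open>N\<close> of Lebesgue measure is translation invariant, hence a multiple of Lebesgue
  measure by a double integral over \<open>(x, y) \<mapsto> (x, x + y)\<close>; the unit ball fixes the factor.\<close>

lemma distr_lborel_orthogonal:
  fixes T :: "'a::euclidean_space \<Rightarrow> 'a"
  assumes T: "orthogonal_transformation T"
  shows "distr lborel borel T = lborel"
proof -
  have lin: "linear T" and norm_T: "\<And>x. norm (T x) = norm x"
    using T by (auto simp: orthogonal_transformation)
  have contT: "continuous_on UNIV T"
    using lin by (simp add: linear_continuous_on linear_conv_bounded_linear)
  have [measurable]: "T \<in> borel_measurable borel"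
    using contT by (rule borel_measurable_continuous_onI)
  have surjT: "surj T"
    using T by (rule orthogonal_transformation_surj)
  define N where "N = distr lborel borel T"
  have sets_N[measurable_cong, simp]: "sets N = sets borel"
    by (simp add: N_def)
  have tr_l: "(\<integral>\<^sup>+x. f (x + c) \<partial>lborel) = (\<integral>\<^sup>+x. f x \<partial>lborel)"
    if [measurable]: "f \<in> borel_measurable borel" for f :: "'a \<Rightarrow> ennreal" and c
  proof -
    have "(\<integral>\<^sup>+x. f x \<partial>lborel) = (\<integral>\<^sup>+x. f x \<partial>distr lborel borel ((+) c))"
      by (simp add: lborel_distr_plus)
    also have "\<dots> = (\<integral>\<^sup>+x. f (x + c) \<partial>lborel)"
      by (subst nn_integral_distr) (auto simp: add.commute)
    finally show ?thesis by simp
  qed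
  have tr_N: "(\<integral>\<^sup>+x. f (x + c) \<partial>N) = (\<integral>\<^sup>+x. f x \<partial>N)"
    if [measurable]: "f \<in> borel_measurable borel" for f :: "'a \<Rightarrow> ennreal" and c
  proof -
    \<comment> \<open>Surjectivity of \<open>T\<close> pulls the shift back: shifting
      \<open>N\<close> by \<open>T c'\<close> is shifting Lebesgue measure by
      \<open>c'\<close>.\<close>
    obtain c' where c: "c = T c'" using surjT by auto
    have "(\<integral>\<^sup>+x. f (x + c) \<partial>N) = (\<integral>\<^sup>+x. f (T (x + c')) \<partial>lborel)"
      by (simp add: N_def nn_integral_distr c linear_add[OF lin])
    also have "\<dots> = (\<integral>\<^sup>+x. f (T x) \<partial>lborel)"
      by (rule tr_l) measurable
    finally show ?thesis by (simp add: N_def nn_integral_distr)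
  qed
  define B where "B = cball (0::'a) 1"
  have [measurable]: "B \<in> sets borel" by (simp add: B_def)
  have TB: "T -` B = B" by (auto simp: B_def norm_T)
  have NB: "emeasure N B = emeasure lborel B"
    by (simp add: N_def emeasure_distr TB)
  have fin: "emeasure lborel B < \<infinity>"
    unfolding B_def by (rule emeasure_bounded_finite) simp
  have "emeasure lborel (ball (0::'a) 1) \<noteq> 0"
    using open_not_negligible[of "ball (0::'a) 1"]
    by (auto simp: negligible_iff_emeasure0)
  then have "0 < emeasure lborel (ball (0::'a) 1)"
    by (simp add: zero_less_iff_neq_zero)
  also have "\<dots> \<le> emeasure lborel B"
    by (intro emeasure_mono) (auto simp: B_def)
  finally have pos: "emeasure lborel B > 0" .
  have sig_N: "sigma_finite_measure N"
  proof
    have "\<exists>A::nat \<Rightarrow> 'a set. range A \<subseteq> sets N \<and> \<Union>(range A) = space N \<and> (\<forall>i. emeasure N (A i) \<noteq> \<infinity>)"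
    proof (intro exI conjI allI)
      show "range (\<lambda>n. cball (0::'a) (real n)) \<subseteq> sets N" by auto
      show "\<Union>(range (\<lambda>n. cball (0::'a) (real n))) = space N"
        by (auto simp: N_def real_arch_simple)
      fix i
      have "T -` cball 0 (real i) = cball 0 (real i)" by (auto simp: norm_T)
      then have "emeasure N (cball 0 (real i)) = emeasure lborel (cball (0::'a) (real i))"
        by (simp add: N_def emeasure_distr)
      also have "\<dots> < \<infinity>" by (rule emeasure_bounded_finite) simp
      finally show "emeasure N (cball (0::'a) (real i)) \<noteq> \<infinity>" by simp
    qed
    then obtain A where "range A \<subseteq> sets N \<and> \<Union>(range A) = space N \<and> (\<forall>i::nat. emeasure N (A i) \<noteq> \<infinity>)" by blast
    then show "\<exists>A. countable A \<and> A \<subseteq> sets N \<and> \<Union> A = space N \<and> (\<forall>a\<in>A. emeasure N a \<noteq> \<infinity>)"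
      by (intro exI[of _ "range A"]) auto
  qed
  interpret N: sigma_finite_measure N by fact
  interpret P: pair_sigma_finite lborel N by standard
  have key: "emeasure lborel B * emeasure N G = emeasure lborel G * emeasure lborel B"
    if [measurable]: "G \<in> sets borel" for G
  proof -
    have sp: "space N = UNIV" by (simp add: N_def)
    have "emeasure lborel B * emeasure N G = (\<integral>\<^sup>+x. indicator B x * emeasure N G \<partial>lborel)"
      by (simp add: nn_integral_multc)
    also have "\<dots> = (\<integral>\<^sup>+x. (\<integral>\<^sup>+y. indicator B x * indicator G (y + x) \<partial>N) \<partial>lborel)"
    proof (rule nn_integral_cong)
      fix x :: 'a
      have "(\<integral>\<^sup>+y. indicator G (y + x) \<partial>N) = emeasure N G"
        by (subst tr_N) auto
      then show "indicator B x * emeasure N G = (\<integral>\<^sup>+y. indicator B x * indicator G (y + x) \<partial>N)"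
        by (subst nn_integral_cmult) auto
    qed
    also have "\<dots> = (\<integral>\<^sup>+y. (\<integral>\<^sup>+x. indicator B x * indicator G (y + x) \<partial>lborel) \<partial>N)"
      by (rule P.Fubini'[symmetric]) measurable
    also have "\<dots> = (\<integral>\<^sup>+y. (\<integral>\<^sup>+x. indicator B (x - y) * indicator G x \<partial>lborel) \<partial>N)"
    proof (rule nn_integral_cong)
      fix y :: 'a
      show "(\<integral>\<^sup>+x. indicator B x * indicator G (y + x) \<partial>lborel)
        = (\<integral>\<^sup>+x. indicator B (x - y) * indicator G x \<partial>lborel)"
        by (subst tr_l[of _ y, symmetric]) (auto simp: add.commute)
    qed
    also have "\<dots> = (\<integral>\<^sup>+x. (\<integral>\<^sup>+y. indicator B (x - y) * indicator G x \<partial>N) \<partial>lborel)"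
      by (rule P.Fubini') measurable
    also have "\<dots> = (\<integral>\<^sup>+x. emeasure lborel B * indicator G x \<partial>lborel)"
    proof (rule nn_integral_cong)
      fix x :: 'a
      \<comment> \<open>The ball is symmetric, so \<open>x - y\<close> may be replaced by
        \<open>y - x\<close>, and the shift disappears by invariance of \<open>N\<close>.\<close>
      have "(\<integral>\<^sup>+y. indicator B (x - y) \<partial>N) = (\<integral>\<^sup>+y. indicator B (y + (- x)) \<partial>N)"
        by (intro nn_integral_cong) (auto simp: B_def norm_minus_commute indicator_def)
      also have "\<dots> = emeasure N B"
        by (subst tr_N) auto
      finally show "(\<integral>\<^sup>+y. indicator B (x - y) * indicator G x \<partial>N) = emeasure lborel B * indicator G x"
        using NB by (subst nn_integral_multc) auto
    qed
    also have "\<dots> = emeasure lborel G * emeasure lborel B"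
      by (subst nn_integral_cmult) (auto simp: mult.commute)
    finally show ?thesis .
  qed
  show ?thesis
  proof (rule measure_eqI)
    fix A assume A: "A \<in> sets (distr lborel borel T)"
    have "emeasure lborel B * emeasure N A = emeasure lborel B * emeasure lborel A"
      using key[of A] A by (simp add: mult.commute)
    then have "emeasure N A = emeasure lborel A"
      using pos fin by (subst (asm) ennreal_mult_cancel_left) auto
    then show "emeasure (distr lborel borel T) A = emeasure lborel A"
      by (simp add: N_def)
  qed simp
qed

text \<open>Writing the vector as a finite combination of the basis vectors \<open>axis i b\<close>
  reduces measurability to the components.\<close>

lemma measurable_vec_lambda:
  "(\<lambda>x. \<chi> i. x i) \<in> (\<Pi>\<^sub>M i\<in>(UNIV::'m::finite set). borel) \<rightarrow>\<^sub>M (borel :: ('a::euclidean_space ^ 'm) measure)"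
proof -
  have "(\<lambda>x. \<Sum>i\<in>UNIV. \<Sum>b\<in>Basis. (x i \<bullet> b) *\<^sub>R axis i b) \<in> (\<Pi>\<^sub>M i\<in>(UNIV::'m::finite set). borel) \<rightarrow>\<^sub>M (borel :: ('a::euclidean_space ^ 'm) measure)"
    by measurable
  also have "(\<lambda>x. \<Sum>i\<in>UNIV. \<Sum>b\<in>Basis. (x i \<bullet> b) *\<^sub>R axis i b :: 'a^'m) = (\<lambda>x. \<chi> i. x i)"
  proof
    fix x :: "'m \<Rightarrow> 'a"
    show "(\<Sum>i\<in>UNIV. \<Sum>b\<in>Basis. (x i \<bullet> b) *\<^sub>R axis i b) = (\<chi> i. x i)"
      unfolding vec_eq_iff
    proof
      fix j
      have "(\<Sum>i\<in>UNIV. \<Sum>b\<in>Basis. (x i \<bullet> b) *\<^sub>R axis i b) $ j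
        = (\<Sum>i\<in>UNIV. if i = j then (\<Sum>b\<in>Basis. (x i \<bullet> b) *\<^sub>R b) else 0)"
        unfolding sum_component by (intro sum.cong refl) (auto simp: axis_def)
      then show "(\<Sum>i\<in>UNIV. \<Sum>b\<in>Basis. (x i \<bullet> b) *\<^sub>R axis i b) $ j = (\<chi> i. x i) $ j"
        by (simp add: euclidean_representation)
    qed
  qed
  finally show ?thesis .
qed

lemma measurable_vec_nth':
  "(\<lambda>x. x $ i) \<in> borel_measurable (borel :: ('a::euclidean_space ^ 'm::finite) measure)"
  by (intro borel_measurable_continuous_onI continuous_intros)

text \<open>Lebesgue measure is determined by the volumes of boxes, and a box of the vector type is
  a product of boxes of the components.\<close>

lemma lborel_vec:
  "(lborel :: ('a::euclidean_space ^ 'm::finite) measure)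
     = distr (\<Pi>\<^sub>M i\<in>UNIV. lborel) borel (\<lambda>x. \<chi> i. x i)"
proof (rule lborel_eqI)
  interpret product_sigma_finite "\<lambda>_::'m. lborel :: 'a measure" by standard
  have m: "(\<lambda>x. \<chi> i. x i) \<in> (\<Pi>\<^sub>M i\<in>(UNIV::'m set). (lborel::'a measure)) \<rightarrow>\<^sub>M borel"
    using measurable_vec_lambda[where ?'a='a and ?'m='m]
    by (subst measurable_cong_sets[OF sets_PiM_cong[OF refl] refl]) auto
  fix l u :: "'a^'m" assume le: "\<And>b. b \<in> Basis \<Longrightarrow> l \<bullet> b \<le> u \<bullet> b"
  have le': "l $ i \<bullet> b \<le> u $ i \<bullet> b" if "b \<in> Basis" for i b
    using le[of "axis i b"] that by (auto simp: inner_axis Basis_vec_def)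
  have "emeasure (distr (\<Pi>\<^sub>M i\<in>UNIV. lborel) borel (\<lambda>x. \<chi> i. x i)) (box l u)
    = emeasure (\<Pi>\<^sub>M i\<in>UNIV. lborel) (PiE UNIV (\<lambda>i. box (l $ i) (u $ i)))"
  proof (subst emeasure_distr[OF m])
    have "(\<lambda>x. \<chi> i. x i) -` box l u \<inter> space (\<Pi>\<^sub>M i\<in>UNIV. lborel) = PiE UNIV (\<lambda>i. box (l $ i) (u $ i))"
      by (auto simp: space_PiM box_def Basis_vec_def inner_axis PiE_def)
    then show "emeasure (\<Pi>\<^sub>M i\<in>UNIV. lborel) ((\<lambda>x. \<chi> i. x i) -` box l u \<inter> space (\<Pi>\<^sub>M i\<in>UNIV. lborel))
      = emeasure (\<Pi>\<^sub>M i\<in>UNIV. lborel) (PiE UNIV (\<lambda>i. box (l $ i) (u $ i)))"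
      by simp
  qed simp
  also have "\<dots> = (\<Prod>i\<in>UNIV. emeasure lborel (box (l $ i) (u $ i)))"
    by (subst emeasure_PiM) auto
  also have "\<dots> = (\<Prod>i\<in>UNIV. ennreal (\<Prod>b\<in>Basis. (u $ i - l $ i) \<bullet> b))"
    using le' by (intro prod.cong refl emeasure_lborel_box) auto
  also have "\<dots> = ennreal (\<Prod>i\<in>UNIV. \<Prod>b\<in>Basis. (u $ i - l $ i) \<bullet> b)"
    using le' by (subst prod_ennreal) (auto intro!: prod_nonneg simp: inner_diff_left)
  also have "(\<Prod>i\<in>UNIV. \<Prod>b\<in>Basis. (u $ i - l $ i) \<bullet> b) = (\<Prod>b\<in>Basis. (u - l) \<bullet> b)"
  proof -
    have "(Basis :: ('a^'m) set) = (\<lambda>(i, b). axis i b) ` (UNIV \<times> Basis)"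
      by (auto simp: Basis_vec_def)
    moreover have "inj_on (\<lambda>(i, b). axis i b :: 'a^'m) (UNIV \<times> Basis)"
      by (auto simp: inj_on_def axis_eq_axis nonzero_Basis)
    ultimately have "(\<Prod>b\<in>Basis. (u - l) \<bullet> b) = (\<Prod>(i, b)\<in>UNIV \<times> Basis. (u - l) \<bullet> axis i b)"
      by (subst (1) \<open>Basis = _\<close>, subst prod.reindex) (auto intro!: prod.cong)
    also have "\<dots> = (\<Prod>(i, b)\<in>UNIV \<times> Basis. (u $ i - l $ i) \<bullet> b)"
      by (intro prod.cong) (auto simp: inner_axis)
    finally show ?thesis
      by (simp add: prod.cartesian_product)
  qed
  finally show "emeasure (distr (\<Pi>\<^sub>M i\<in>UNIV. lborel) borel (\<lambda>x. \<chi> i. x i)) (box l u) = (\<Prod>b\<in>Basis. (u - l) \<bullet> b)" .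
qed simp

text \<open>Defined on every Euclidean space at once, since it serves for a single point, for the
  matrix of all points and for the vector \<open>g\<close>; the norm in the density makes the
  invariance under isometries visible.\<close>

definition gauss :: "'a::euclidean_space measure" where
  "gauss = density lborel (\<lambda>x. ennreal (exp (- ((norm x)\<^sup>2 / 2)) / sqrt (2 * pi) ^ DIM('a)))"

lemma sets_gauss[simp, measurable_cong]: "sets gauss = sets borel"
  and space_gauss[simp]: "space gauss = UNIV"
  by (simp_all add: gauss_def)

lemma gauss_density_prod_Basis:
  "exp (- ((norm x)\<^sup>2 / 2)) / sqrt (2 * pi) ^ DIM('a) = (\<Prod>b\<in>Basis. std_normal_density (x \<bullet> b))"
  for x :: "'a::euclidean_space"
proof -
  have "(norm x)\<^sup>2 = (\<Sum>b\<in>Basis. (x \<bullet> b)\<^sup>2)"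
    by (subst power2_norm_eq_inner, subst euclidean_inner) (simp add: power2_eq_square)
  then have "exp (- ((norm x)\<^sup>2 / 2)) = (\<Prod>b\<in>Basis. exp (- ((x \<bullet> b)\<^sup>2 / 2)))"
    by (simp add: exp_sum sum_divide_distrib flip: sum_negf)
  moreover have "std_normal_density y = exp (- (y\<^sup>2 / 2)) / sqrt (2 * pi)" for y
    by (simp add: std_normal_density_def)
  ultimately show ?thesis
    by (simp add: prod_dividef)
qed

lemma prob_space_gauss: "prob_space (gauss :: 'a::euclidean_space measure)"
proof
  have "emeasure (gauss :: 'a measure) (space gauss)
      = (\<integral>\<^sup>+x. (\<Prod>b\<in>(Basis::'a set). ennreal (std_normal_density (x \<bullet> b))) \<partial>lborel)"
    by (simp add: gauss_def emeasure_density prod_ennreal gauss_density_prod_Basis)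
  also have "\<dots> = (\<Prod>b\<in>(Basis::'a set). \<integral>\<^sup>+x. ennreal (std_normal_density x) \<partial>lborel)"
    by (subst nn_integral_lborel_prod) auto
  also have "\<dots> = 1"
    using prob_space.emeasure_space_1[OF prob_space_normal_density[of 1 0]]
    by (simp add: emeasure_density)
  finally show "emeasure (gauss :: 'a measure) (space gauss) = 1" .
qed

lemma distr_gauss_orthogonal:
  fixes T :: "'a::euclidean_space \<Rightarrow> 'a"
  assumes T: "orthogonal_transformation T"
  shows "distr gauss borel T = gauss"
proof -
  have [measurable]: "T \<in> borel_measurable borel"
    using T by (intro borel_measurable_continuous_onI linear_continuous_on)
       (auto simp: orthogonal_transformation linear_conv_bounded_linear)
  have n: "norm (T x) = norm x" for x using T by (rule orthogonal_transformation_norm)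
  show ?thesis
  proof (rule measure_eqI)
    fix A assume "A \<in> sets (distr gauss borel T)"
    then have [measurable]: "A \<in> sets borel" by simp
    have "emeasure gauss A = (\<integral>\<^sup>+x. ennreal (exp (- ((norm x)\<^sup>2 / 2)) / sqrt (2 * pi) ^ DIM('a)) * indicator A x \<partial>distr lborel borel T)"
      by (simp add: gauss_def emeasure_density distr_lborel_orthogonal[OF T])
    also have "\<dots> = (\<integral>\<^sup>+x. ennreal (exp (- ((norm x)\<^sup>2 / 2)) / sqrt (2 * pi) ^ DIM('a)) * indicator (T -` A) x \<partial>lborel)"
      by (subst nn_integral_distr) (auto simp: n indicator_def intro!: nn_integral_cong)
    also have "\<dots> = emeasure gauss (T -` A)"
      using measurable_sets[of T borel borel A] by (simp add: gauss_def emeasure_density)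
    also have "\<dots> = emeasure (distr gauss borel T) A"
      by (subst emeasure_distr) auto
    finally show "emeasure (distr gauss borel T) A = emeasure gauss A" by simp
  qed simp
qed

text \<open>The Gaussian density vanishes nowhere, so null sets can be recognised with Lebesgue
  measure.\<close>

lemma emeasure_gauss_eq_0_iff:
  assumes "A \<in> sets borel"
  shows "emeasure gauss A = 0 \<longleftrightarrow> emeasure lborel A = 0"
proof -
  have "emeasure gauss A = 0 \<longleftrightarrow> (AE x in lborel. x \<notin> A)"
    unfolding gauss_def using assms
    by (subst emeasure_density) (auto simp: nn_integral_0_iff_AE indicator_def)
  also have "\<dots> \<longleftrightarrow> emeasure lborel A = 0"
    using assms by (subst AE_iff_measurable[of A]) auto
  finally show ?thesis .
qed

lemma std_normal_vec_density_eq: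
  "std_normal_vec_density x = exp (- ((norm x)\<^sup>2 / 2)) / sqrt (2 * pi) ^ CARD('d)"
  for x :: "real ^ 'd"
proof -
  have "Basis = (\<lambda>i. axis i 1 :: real^'d) ` UNIV" by (auto simp: Basis_vec_def)
  moreover have "inj (\<lambda>i. axis i 1 :: real^'d)" by (auto simp: inj_on_def axis_eq_axis)
  ultimately have "(\<Prod>b\<in>Basis. std_normal_density (x \<bullet> b)) = std_normal_vec_density x"
    unfolding std_normal_vec_density_def
    by (subst (1) \<open>Basis = _\<close>, subst prod.reindex) (simp_all add: inner_axis)
  then show ?thesis by (simp add: gauss_density_prod_Basis[symmetric])
qed

text \<open>The squared norm is additive over the components, so the density factorises. This makes
  a family of independent Gaussian points one Gaussian matrix.\<close>

lemma gauss_vec: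
  "(gauss :: ('a::euclidean_space ^ 'm::finite) measure) = distr (\<Pi>\<^sub>M i\<in>UNIV. gauss) borel (\<lambda>x. \<chi> i. x i)"
proof -
  interpret L: product_sigma_finite "\<lambda>_::'m. lborel :: 'a measure" by standard
  interpret G: prob_space "gauss :: 'a measure" by (rule prob_space_gauss)
  interpret product_sigma_finite "\<lambda>_::'m. gauss :: 'a measure" by standard
  have m[measurable]: "(\<lambda>x. \<chi> i. x i) \<in> (\<Pi>\<^sub>M i\<in>(UNIV::'m set). (lborel::'a measure)) \<rightarrow>\<^sub>M borel"
    using measurable_vec_lambda[where ?'a='a and ?'m='m]
    by (subst measurable_cong_sets[OF sets_PiM_cong[OF refl] refl]) auto
  have m1[measurable]: "(\<lambda>x. \<chi> i. x i) \<in> (\<Pi>\<^sub>M i\<in>(UNIV::'m set). (gauss::'a measure)) \<rightarrow>\<^sub>M borel"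
    using measurable_vec_lambda[where ?'a='a and ?'m='m]
    by (subst measurable_cong_sets[OF sets_PiM_cong[OF refl] refl]) auto
  note measurable_vec_nth'[measurable]
  have m2[measurable]: "(\<lambda>x. vec_nth x) \<in> borel \<rightarrow>\<^sub>M (\<Pi>\<^sub>M i\<in>(UNIV::'m set). (gauss::'a measure))"
    by (rule measurable_PiM_single') (auto simp: measurable_cong_sets[OF refl sets_gauss])
  have "distr gauss (\<Pi>\<^sub>M i\<in>UNIV. gauss) (\<lambda>x::'a^'m. vec_nth x) = (\<Pi>\<^sub>M i\<in>UNIV. gauss)"
  proof (rule PiM_eqI)
    fix A :: "'m \<Rightarrow> 'a set" assume "\<And>i. i \<in> UNIV \<Longrightarrow> A i \<in> sets gauss"
    then have A[measurable]: "A i \<in> sets borel" for i by simp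
    have eq: "exp (- ((norm x)\<^sup>2 / 2)) / sqrt (2 * pi) ^ (CARD('m) * DIM('a))
       = (\<Prod>i\<in>UNIV. exp (- ((norm (x $ i))\<^sup>2 / 2)) / sqrt (2 * pi) ^ DIM('a))" for x :: "'a^'m"
    proof -
      have "(norm x)\<^sup>2 = (\<Sum>i\<in>UNIV. (norm (x $ i))\<^sup>2)"
        by (simp add: norm_vec_def L2_set_def sum_nonneg)
      then have "exp (- ((norm x)\<^sup>2 / 2)) = (\<Prod>i\<in>UNIV. exp (- ((norm (x $ i))\<^sup>2 / 2)))"
        by (simp add: exp_sum sum_divide_distrib flip: sum_negf)
      then show ?thesis
        by (simp add: prod_dividef power_mult power_commutes flip: power_mult) (simp add: mult.commute)
    qed
    have ind: "indicator (vec_nth -` PiE UNIV A) x = (\<Prod>i\<in>UNIV. indicator (A i) (x $ i) :: ennreal)" for x :: "'a^'m"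
      by (auto simp: indicator_def PiE_def Pi_def prod_zero_iff of_bool_def)
    have [measurable]: "(vec_nth -` PiE UNIV A :: ('a^'m) set) \<in> sets borel"
      using measurable_sets[OF m2, of "PiE UNIV A"] by (simp add: sets_PiM_I_finite)
    have "emeasure (distr gauss (\<Pi>\<^sub>M i\<in>UNIV. gauss) (\<lambda>x::'a^'m. vec_nth x)) (PiE UNIV A)
      = emeasure gauss (vec_nth -` PiE UNIV A :: ('a^'m) set)"
      by (subst emeasure_distr) (auto simp: sets_PiM_I_finite measurable_cong_sets[OF sets_gauss refl] m2)
    also have "\<dots> = (\<integral>\<^sup>+x. (\<Prod>i\<in>UNIV. ennreal (exp (- ((norm (x $ i))\<^sup>2 / 2)) / sqrt (2 * pi) ^ DIM('a)) * indicator (A i) (x $ i)) \<partial>(lborel :: ('a^'m) measure))"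
      by (subst gauss_def, subst emeasure_density) (auto simp: eq ind prod.distrib prod_ennreal)
    also have "\<dots> = (\<integral>\<^sup>+x. (\<Prod>i\<in>UNIV. ennreal (exp (- ((norm (x i))\<^sup>2 / 2)) / sqrt (2 * pi) ^ DIM('a)) * indicator (A i) (x i)) \<partial>(\<Pi>\<^sub>M i\<in>UNIV. lborel))"
      by (subst lborel_vec, subst nn_integral_distr) auto
    also have "\<dots> = (\<Prod>i\<in>UNIV. \<integral>\<^sup>+x. ennreal (exp (- ((norm x)\<^sup>2 / 2)) / sqrt (2 * pi) ^ DIM('a)) * indicator (A i) x \<partial>lborel)"
      by (rule L.product_nn_integral_prod) auto
    also have "\<dots> = (\<Prod>i\<in>UNIV. emeasure gauss (A i))"
      by (simp add: gauss_def emeasure_density)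
    finally show "emeasure (distr gauss (\<Pi>\<^sub>M i\<in>UNIV. gauss) (\<lambda>x::'a^'m. vec_nth x)) (PiE UNIV A) = (\<Prod>i\<in>UNIV. emeasure gauss (A i))" .
  qed auto
  then have "distr (\<Pi>\<^sub>M i\<in>UNIV. gauss) borel (\<lambda>x. \<chi> i. x i) = distr (distr gauss (\<Pi>\<^sub>M i\<in>UNIV. gauss) (\<lambda>x::'a^'m. vec_nth x)) borel (\<lambda>x. \<chi> i. x i)"
    by simp
  also have "\<dots> = distr gauss borel (\<lambda>x. x)"
    using m1 m2 by (subst distr_distr) (auto simp: o_def measurable_cong_sets[OF sets_gauss refl])
  also have "\<dots> = gauss" by (rule distr_id2) simp
  finally show ?thesis by simp
qed

section \<open>Isotropic measures on lines\<close>

text \<open>Integrate the indicator \<open>K r\<close> of the pairs of lines with small angle over \<open>(M, N)\<close>. All its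
  partial integrals have the same value \<open>c r\<close>, so \<open>c r * M (D r) \<le> c r * N U\<close>; let \<open>r\<close> tend to \<open>1\<close>.\<close>

lemma double_cap_le:
  fixes M N :: "'a::euclidean_space measure"
  assumes M: "prob_space M" "sets M = sets borel" "AE x in M. x \<in> V \<and> x \<noteq> 0"
    and N: "prob_space N" "sets N = sets borel" "AE x in N. x \<in> V \<and> x \<noteq> 0"
    and V: "\<And>c x. x \<in> V \<Longrightarrow> c *\<^sub>R x \<in> V"
    and iM: "\<And>r y z. y \<in> V \<Longrightarrow> z \<in> V \<Longrightarrow> norm y = 1 \<Longrightarrow> norm z = 1 \<Longrightarrow>
        emeasure M {x. \<bar>x \<bullet> y\<bar> > r * norm x} = emeasure M {x. \<bar>x \<bullet> z\<bar> > r * norm x}"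
    and iN: "\<And>r y z. y \<in> V \<Longrightarrow> z \<in> V \<Longrightarrow> norm y = 1 \<Longrightarrow> norm z = 1 \<Longrightarrow>
        emeasure N {x. \<bar>x \<bullet> y\<bar> > r * norm x} = emeasure N {x. \<bar>x \<bullet> z\<bar> > r * norm x}"
    and pos: "(\<exists>P\<in>{M, N}. \<forall>r y. y \<in> V \<longrightarrow> norm y = 1 \<longrightarrow> r < 1 \<longrightarrow> emeasure P {x. \<bar>x \<bullet> y\<bar> > r * norm x} \<noteq> 0)"
    and U: "open U" "\<And>c x. x \<in> U \<Longrightarrow> c \<noteq> 0 \<Longrightarrow> c *\<^sub>R x \<in> U"
  shows "emeasure M U \<le> emeasure N U"
proof -
  interpret M: prob_space M by fact
  interpret N: prob_space N by fact
  interpret P: pair_sigma_finite M N by standard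
  note [measurable_cong, simp] = M(2) N(2)
  have sp[simp]: "space M = UNIV" "space N = UNIV"
    using sets_eq_imp_space_eq[OF M(2)] sets_eq_imp_space_eq[OF N(2)] by auto
  have "\<exists>v. v \<in> V \<and> v \<noteq> 0"
  proof (rule ccontr)
    assume *: "\<nexists>v. v \<in> V \<and> v \<noteq> 0"
    have "AE x in M. False" using M(3) by eventually_elim (use * in auto)
    then show False by simp
  qed
  then obtain v where v: "v \<in> V" "v \<noteq> 0" by blast
  define e where "e = v /\<^sub>R norm v"
  have e: "e \<in> V" "norm e = 1" using v V by (auto simp: e_def)
  define K where "K r = {p :: 'a \<times> 'a. r * norm (fst p) * norm (snd p) < \<bar>fst p \<bullet> snd p\<bar>}" for r
  have "open (K r)" for r
    unfolding K_def by (intro open_Collect_less continuous_intros)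
  then have K[measurable]: "K r \<in> sets borel" for r by auto
  have K'[measurable]: "K r \<in> sets (borel \<Otimes>\<^sub>M borel)" for r
    unfolding borel_prod by (rule K)
  have Ksym: "(x, y) \<in> K r \<longleftrightarrow> (y, x) \<in> K r" for x y r
    by (simp add: K_def inner_commute mult.commute mult.left_commute)
  have Kset: "{x. (x, y) \<in> K r} = {x. \<bar>x \<bullet> (y /\<^sub>R norm y)\<bar> > r * norm x}" if "y \<noteq> 0" for y r
    using that by (auto simp: K_def abs_mult field_simps)
  have cM: "emeasure M {x. (x, y) \<in> K r} = emeasure M {x. (x, e) \<in> K r}" if "y \<in> V" "y \<noteq> 0" for y r
    using that e iM[of "y /\<^sub>R norm y" e r] V by (subst (1 2) Kset) auto
  have cN: "emeasure N {x. (x, y) \<in> K r} = emeasure N {x. (x, e) \<in> K r}" if "y \<in> V" "y \<noteq> 0" for y r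
    using that e iN[of "y /\<^sub>R norm y" e r] V by (subst (1 2) Kset) auto
  define c where "c r = emeasure M {x. (x, e) \<in> K r}" for r
  \<comment> \<open>Integrating \<open>K r\<close> in both orders shows that caps have the same mass
    under \<open>M\<close> and under \<open>N\<close>.\<close>
  have "c r = (\<integral>\<^sup>+y. c r \<partial>N)" for r
    by (simp add: N.emeasure_space_1[simplified])
  also have "\<dots> r = (\<integral>\<^sup>+y. (\<integral>\<^sup>+x. indicator (K r) (x, y) \<partial>M) \<partial>N)" for r
  proof (rule nn_integral_cong_AE)
    show "AE y in N. c r = (\<integral>\<^sup>+x. indicator (K r) (x, y) \<partial>M)"
      using N(3)
    proof eventually_elim
      case (elim y)
      have "(\<integral>\<^sup>+x. indicator (K r) (x, y) \<partial>M) = (\<integral>\<^sup>+x. indicator {x. (x, y) \<in> K r} x \<partial>M)"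
        by (intro nn_integral_cong) (auto simp: indicator_def)
      also have "\<dots> = emeasure M {x. (x, y) \<in> K r}"
        by (rule nn_integral_indicator) simp
      finally show ?case using cM[of y r] elim by (simp add: c_def)
    qed
  qed
  also have "\<dots> r = (\<integral>\<^sup>+x. (\<integral>\<^sup>+y. indicator (K r) (x, y) \<partial>N) \<partial>M)" for r
    by (rule P.Fubini') simp
  also have "\<dots> r = (\<integral>\<^sup>+x. emeasure N {x. (x, e) \<in> K r} \<partial>M)" for r
  proof (rule nn_integral_cong_AE)
    show "AE x in M. (\<integral>\<^sup>+y. indicator (K r) (x, y) \<partial>N) = emeasure N {x. (x, e) \<in> K r}"
      using M(3)
    proof eventually_elim
      case (elim x)
      have "(\<integral>\<^sup>+y. indicator (K r) (x, y) \<partial>N) = (\<integral>\<^sup>+y. indicator {y. (y, x) \<in> K r} y \<partial>N)"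
        using Ksym by (intro nn_integral_cong) (auto simp: indicator_def)
      also have "\<dots> = emeasure N {y. (y, x) \<in> K r}"
        by (rule nn_integral_indicator) simp
      finally show ?case using cN[of x r] elim by simp
    qed
  qed
  also have "\<dots> r = emeasure N {x. (x, e) \<in> K r}" for r
    by (simp add: M.emeasure_space_1[simplified])
  finally have cc: "c r = emeasure N {x. (x, e) \<in> K r}" for r .
  \<comment> \<open>By \<open>cc\<close> the value \<open>c r\<close> can be computed with either
    measure, so it is enough that one of them charges the caps.\<close>
  have c0: "c r \<noteq> 0" if "r < 1" for r
  proof -
    have "{x. (x, e) \<in> K r} = {x. \<bar>x \<bullet> e\<bar> > r * norm x}" using e by (auto simp: K_def)
    then show ?thesis using pos e that cc[of r] c_def[of r] by auto
  qed
  \<comment> \<open>A shrunken version of \<open>U\<close>: around each line in \<open>D r\<close>,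
    the whole double cone of opening \<open>r\<close> lies in \<open>U\<close>, apart from
    \<open>0\<close>.\<close>
  define D where "D r = {x. x \<noteq> 0 \<and> (\<forall>y. y \<noteq> 0 \<longrightarrow> (x, y) \<in> K r \<longrightarrow> y \<in> U)}" for r
  have D[measurable]: "D r \<in> sets borel" for r
  proof -
    \<comment> \<open>The quantifier over \<open>y\<close> is uncountable, but the complement of
      \<open>D r\<close> is \<open>{0}\<close> together with a union of open sets.\<close>
    have "open {x. (x, y) \<in> K r}" for y
      unfolding K_def mem_Collect_eq fst_conv snd_conv by (intro open_Collect_less continuous_intros)
    then have "open (\<Union>y\<in>- U - {0}. {x. (x, y) \<in> K r})" by auto
    moreover have "D r = - {0} - (\<Union>y\<in>- U - {0}. {x. (x, y) \<in> K r})"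
      by (auto simp: D_def)
    ultimately show ?thesis by auto
  qed
  have [measurable]: "U \<in> sets borel" using U by auto
  have le: "emeasure M (D r) \<le> emeasure N U" if r: "r < 1" for r
  proof -
    have "c r * emeasure M (D r) = (\<integral>\<^sup>+x. indicator (D r) x * c r \<partial>M)"
      by (subst nn_integral_multc) (auto simp: mult.commute)
    also have "\<dots> = (\<integral>\<^sup>+x. (\<integral>\<^sup>+y. indicator (D r) x * indicator (K r) (x, y) \<partial>N) \<partial>M)"
    proof (rule nn_integral_cong_AE)
      show "AE x in M. indicator (D r) x * c r = (\<integral>\<^sup>+y. indicator (D r) x * indicator (K r) (x, y) \<partial>N)"
        using M(3)
      proof eventually_elim
        case (elim x)
        have "(\<integral>\<^sup>+y. indicator (K r) (x, y) \<partial>N) = (\<integral>\<^sup>+y. indicator {y. (y, x) \<in> K r} y \<partial>N)"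
          using Ksym by (intro nn_integral_cong) (auto simp: indicator_def)
        also have "\<dots> = emeasure N {y. (y, x) \<in> K r}"
          by (rule nn_integral_indicator) simp
        finally have "(\<integral>\<^sup>+y. indicator (K r) (x, y) \<partial>N) = c r" using cN[of x r] elim cc by simp
        then show ?case by (subst nn_integral_cmult) auto
      qed
    qed
    also have "\<dots> \<le> (\<integral>\<^sup>+x. (\<integral>\<^sup>+y. indicator U y * indicator (K r) (x, y) \<partial>N) \<partial>M)"
    proof (rule nn_integral_mono, rule nn_integral_mono_AE)
      fix x
      show "AE y in N. indicator (D r) x * indicator (K r) (x, y) \<le> (indicator U y * indicator (K r) (x, y) :: ennreal)"
        using N(3) by eventually_elim (auto simp: D_def indicator_def)
    qed
    also have "\<dots> = (\<integral>\<^sup>+y. (\<integral>\<^sup>+x. indicator U y * indicator (K r) (x, y) \<partial>M) \<partial>N)"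
      by (rule P.Fubini'[symmetric]) measurable
    also have "\<dots> = (\<integral>\<^sup>+y. indicator U y * c r \<partial>N)"
    proof (rule nn_integral_cong_AE)
      show "AE y in N. (\<integral>\<^sup>+x. indicator U y * indicator (K r) (x, y) \<partial>M) = indicator U y * c r"
        using N(3)
      proof eventually_elim
        case (elim y)
        have "(\<integral>\<^sup>+x. indicator (K r) (x, y) \<partial>M) = (\<integral>\<^sup>+x. indicator {x. (x, y) \<in> K r} x \<partial>M)"
          by (intro nn_integral_cong) (auto simp: indicator_def)
        also have "\<dots> = emeasure M {x. (x, y) \<in> K r}"
          by (rule nn_integral_indicator) simp
        finally show ?case using cM[of y r] elim by (subst nn_integral_cmult) (auto simp: c_def)
      qed
    qed
    also have "\<dots> = c r * emeasure N U"
      by (subst nn_integral_multc) (auto simp: mult.commute)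
    finally have "c r * emeasure M (D r) \<le> c r * emeasure N U" .
    moreover have "c r \<noteq> \<infinity>" "c r \<noteq> 0" using c0[OF r] by (auto simp: c_def)
    ultimately show ?thesis
      by (metis ennreal_mult_le_mult_iff infinity_ennreal_def)
  qed
  define R where "R n = 1 - 1 / real (Suc n)" for n
  have inc: "incseq (\<lambda>n. D (R n))"
  proof (rule incseq_SucI)
    fix n
    have "R n \<le> R (Suc n)" by (simp add: R_def field_simps)
    then have "K (R (Suc n)) \<subseteq> K (R n)"
      by (auto simp: K_def) (smt (verit) mult_right_mono norm_ge_zero)
    then show "D (R n) \<subseteq> D (R (Suc n))" by (auto simp: D_def)
  qed
  have cover: "U - {0} \<subseteq> (\<Union>n. D (R n))"
  proof
    fix x assume x: "x \<in> U - {0}"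
    define u where "u = x /\<^sub>R norm x"
    have u: "u \<in> U" "norm u = 1" using x U(2)[of x "inverse (norm x)"] by (auto simp: u_def)
    obtain d where d: "d > 0" "ball u d \<subseteq> U" using u U(1) by (meson open_contains_ball)
    \<comment> \<open>For unit vectors
      \<open>(norm (u - w))\<^sup>2 = 2 - 2 * (u \<bullet> w)\<close>, and
      \<open>u \<bullet> w > R n\<close> bounds this by \<open>2 / real (Suc n)\<close>.\<close>
    obtain n where n: "2 / real (Suc n) < d\<^sup>2"
    proof -
      obtain n where "2 / d\<^sup>2 < real n" using reals_Archimedean2 by blast
      then have "2 / real (Suc n) < d\<^sup>2" using d by (simp add: field_simps) (smt (verit) zero_less_power)
      then show ?thesis using that by blast
    qed
    have "y \<in> U" if y: "y \<noteq> 0" "(x, y) \<in> K (R n)" for y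
    proof -
      \<comment> \<open>The unit vector on the line of \<open>y\<close> that lies on the same side
        as \<open>x\<close>; stability of \<open>U\<close> under negative factors leads back from
        \<open>w\<close> to \<open>y\<close>.\<close>
      define w where "w = (if x \<bullet> y > 0 then y /\<^sub>R norm y else - (y /\<^sub>R norm y))"
      have w1: "norm w = 1" using y by (auto simp: w_def)
      have "\<bar>x \<bullet> y\<bar> / (norm x * norm y) > R n"
        using y x by (auto simp: K_def field_simps)
      moreover have "u \<bullet> w = \<bar>x \<bullet> y\<bar> / (norm x * norm y)"
        by (auto simp: u_def w_def divide_inverse)
      ultimately have uw: "u \<bullet> w > R n" by simp
      have "(norm (u - w))\<^sup>2 = 2 - 2 * (u \<bullet> w)"
        using u(2) w1 by (simp add: power2_norm_eq_inner inner_diff inner_commute norm_eq_1)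
      also have "\<dots> < 2 / real (Suc n)" using uw by (simp add: R_def)
      also have "\<dots> < d\<^sup>2" by (rule n)
      finally have "norm (u - w) < d" using d(1) by (simp add: power2_less_imp_less)
      then have "w \<in> U" using d by (auto simp: dist_norm)
      then have "(if x \<bullet> y > 0 then norm y else - norm y) *\<^sub>R w \<in> U"
        using y by (intro U(2)) auto
      then show "y \<in> U" using y by (auto simp: w_def split: if_splits)
    qed
    then show "x \<in> (\<Union>n. D (R n))" using x by (auto simp: D_def)
  qed
  have "emeasure M U = emeasure M (U - {0})"
    using M(3) by (intro emeasure_eq_AE) auto
  also have "\<dots> \<le> emeasure M (\<Union>n. D (R n))"
    using cover by (intro emeasure_mono) auto
  also have "\<dots> = (SUP n. emeasure M (D (R n)))"
    using inc by (subst SUP_emeasure_incseq) auto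
  also have "\<dots> \<le> emeasure N U"
    by (intro SUP_least le) (auto simp: R_def)
  finally show ?thesis .
qed

text \<open>The one-sided bound asks for positive caps of either measure, so caps charged by
  \<open>N\<close> allow it to be applied in both directions.\<close>

lemma isotropic_measures_eq:
  fixes M N :: "'a::euclidean_space measure"
  assumes M: "prob_space M" "sets M = sets borel" "AE x in M. x \<in> V \<and> x \<noteq> 0"
    and N: "prob_space N" "sets N = sets borel" "AE x in N. x \<in> V \<and> x \<noteq> 0"
    and V: "\<And>c x. x \<in> V \<Longrightarrow> c *\<^sub>R x \<in> V"
    and iM: "\<And>r y z. y \<in> V \<Longrightarrow> z \<in> V \<Longrightarrow> norm y = 1 \<Longrightarrow> norm z = 1 \<Longrightarrow>
        emeasure M {x. \<bar>x \<bullet> y\<bar> > r * norm x} = emeasure M {x. \<bar>x \<bullet> z\<bar> > r * norm x}"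
    and iN: "\<And>r y z. y \<in> V \<Longrightarrow> z \<in> V \<Longrightarrow> norm y = 1 \<Longrightarrow> norm z = 1 \<Longrightarrow>
        emeasure N {x. \<bar>x \<bullet> y\<bar> > r * norm x} = emeasure N {x. \<bar>x \<bullet> z\<bar> > r * norm x}"
    and pos: "\<And>r y. y \<in> V \<Longrightarrow> norm y = 1 \<Longrightarrow> r < 1 \<Longrightarrow> emeasure N {x. \<bar>x \<bullet> y\<bar> > r * norm x} \<noteq> 0"
    and U: "open U" "\<And>c x. x \<in> U \<Longrightarrow> c \<noteq> 0 \<Longrightarrow> c *\<^sub>R x \<in> U"
  shows "emeasure M U = emeasure N U"
proof (rule antisym)
  show "emeasure M U \<le> emeasure N U"
    by (rule double_cap_le[OF M N V iM iN _ U]) (use pos in auto)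
  show "emeasure N U \<le> emeasure M U"
    by (rule double_cap_le[OF N M V iN iM _ U]) (use pos in auto)
qed

section \<open>Signs of a centered Gaussian vector\<close>

text \<open>Log-concavity in the form of total positivity of order 2: zeros cause no special cases, and it is
  preserved by convolution because of the Cauchy-Binet formula for \<open>2 \<times> 2\<close> determinants.\<close>

definition pf2 :: "(real \<Rightarrow> ennreal) \<Rightarrow> bool" where
  "pf2 f \<longleftrightarrow> f \<in> borel_measurable borel \<and>
     (\<forall>x1 x2 y1 y2. x1 \<le> x2 \<longrightarrow> y1 \<le> y2 \<longrightarrow> f (x1 - y2) * f (x2 - y1) \<le> f (x1 - y1) * f (x2 - y2))"

text \<open>For reals this is \<open>(b - a) * (d - c) \<ge> 0\<close>. Writing
  \<open>b = a + p\<close> and \<open>d = c + q\<close> avoids subtraction: the two sides differ by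
  the summand \<open>p * q\<close>.\<close>

lemma rearrangement_ennreal:
  fixes a b c d :: ennreal
  assumes "a \<le> b" "c \<le> d"
  shows "a * d + b * c \<le> a * c + b * d"
proof -
  obtain p q where "b = a + p" "d = c + q" using assms by (metis le_iff_add)
  then show ?thesis
    by (simp add: algebra_simps add_left_mono)
qed

lemma pf2_convolution:
  assumes f: "pf2 f" and w: "pf2 w"
  shows "pf2 (\<lambda>s. \<integral>\<^sup>+x. f x * w (s - x) \<partial>lborel)"
proof -
  have [measurable]: "f \<in> borel_measurable borel" "w \<in> borel_measurable borel"
    using f w by (auto simp: pf2_def)
  define H where "H s = (\<integral>\<^sup>+x. f x * w (s - x) \<partial>lborel)" for s
  have [measurable]: "H \<in> borel_measurable borel"
    unfolding H_def by measurable
  \<comment> \<open>In this form \<open>H\<close> is the composition of the kernels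
    \<open>w (x - z)\<close> and \<open>f (z - y)\<close>, as the determinant formula
    requires.\<close>
  have H: "H (x - y) = (\<integral>\<^sup>+z. w (x - z) * f (z - y) \<partial>lborel)" for x y
    unfolding H_def by (subst nn_integral_real_affine[where c=1 and t="-y"]) (auto simp: algebra_simps)
  have prod: "H (x1 - y1) * H (x2 - y2) = (\<integral>\<^sup>+z. \<integral>\<^sup>+z'. (w (x1 - z) * f (z - y1)) * (w (x2 - z') * f (z' - y2)) \<partial>lborel \<partial>lborel)"
    for x1 x2 y1 y2
    by (simp add: H nn_integral_cmult nn_integral_multc)
  have prod': "H (x1 - y1) * H (x2 - y2) = (\<integral>\<^sup>+z. \<integral>\<^sup>+z'. (w (x1 - z') * f (z' - y1)) * (w (x2 - z) * f (z - y2)) \<partial>lborel \<partial>lborel)"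
    for x1 x2 y1 y2
    by (simp add: H nn_integral_cmult nn_integral_multc)
  \<comment> \<open>Adding the copy with \<open>z\<close> and \<open>z'\<close> exchanged
    symmetrises the integrand. The difference to be estimated is then pointwise a product of a
    \<open>2 \<times> 2\<close> minor of \<open>w\<close> and one of \<open>f\<close>, whose signs
    are both decided by the order of \<open>z\<close> and \<open>z'\<close>.\<close>
  have two: "2 * (H (x1 - y1) * H (x2 - y2)) = (\<integral>\<^sup>+z. \<integral>\<^sup>+z'. (w (x1 - z) * w (x2 - z')) * (f (z - y1) * f (z' - y2))
     + (w (x1 - z') * w (x2 - z)) * (f (z' - y1) * f (z - y2)) \<partial>lborel \<partial>lborel)" for x1 x2 y1 y2
  proof -
    have "2 * (H (x1 - y1) * H (x2 - y2)) = H (x1 - y1) * H (x2 - y2) + H (x1 - y1) * H (x2 - y2)"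
      by (simp add: mult_2)
    also have "\<dots> = (\<integral>\<^sup>+z. \<integral>\<^sup>+z'. (w (x1 - z) * f (z - y1)) * (w (x2 - z') * f (z' - y2)) \<partial>lborel \<partial>lborel) +
      (\<integral>\<^sup>+z. \<integral>\<^sup>+z'. (w (x1 - z') * f (z' - y1)) * (w (x2 - z) * f (z - y2)) \<partial>lborel \<partial>lborel)"
      by (subst prod[symmetric], subst prod'[symmetric]) simp
    also have "\<dots> = (\<integral>\<^sup>+z. \<integral>\<^sup>+z'. (w (x1 - z) * f (z - y1)) * (w (x2 - z') * f (z' - y2))
      + (w (x1 - z') * f (z' - y1)) * (w (x2 - z) * f (z - y2)) \<partial>lborel \<partial>lborel)"
      by (simp add: nn_integral_add)
    finally show ?thesis by (simp add: ac_simps)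
  qed
  have "H (x1 - y2) * H (x2 - y1) \<le> H (x1 - y1) * H (x2 - y2)" if x: "x1 \<le> x2" and y: "y1 \<le> y2" for x1 x2 y1 y2
  proof -
    have "2 * (H (x1 - y2) * H (x2 - y1)) \<le> 2 * (H (x1 - y1) * H (x2 - y2))"
      unfolding two
    proof (intro nn_integral_mono)
      fix z z' :: real
      show "(w (x1 - z) * w (x2 - z')) * (f (z - y2) * f (z' - y1)) + (w (x1 - z') * w (x2 - z)) * (f (z' - y2) * f (z - y1))
        \<le> (w (x1 - z) * w (x2 - z')) * (f (z - y1) * f (z' - y2)) + (w (x1 - z') * w (x2 - z)) * (f (z' - y1) * f (z - y2))"
      proof (cases "z \<le> z'")
        case True
        have "w (x1 - z') * w (x2 - z) \<le> w (x1 - z) * w (x2 - z')"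
          using w x True by (auto simp: pf2_def)
        moreover have "f (z - y2) * f (z' - y1) \<le> f (z - y1) * f (z' - y2)"
          using f y True by (auto simp: pf2_def)
        ultimately show ?thesis
          using rearrangement_ennreal[of "w (x1 - z') * w (x2 - z)" "w (x1 - z) * w (x2 - z')" "f (z - y2) * f (z' - y1)" "f (z - y1) * f (z' - y2)"]
          by (simp add: ac_simps)
      next
        case False
        have "w (x1 - z) * w (x2 - z') \<le> w (x1 - z') * w (x2 - z)"
          using w x False by (auto simp: pf2_def)
        moreover have "f (z' - y2) * f (z - y1) \<le> f (z' - y1) * f (z - y2)"
          using f y False by (auto simp: pf2_def)
        ultimately show ?thesis
          using rearrangement_ennreal[of "w (x1 - z) * w (x2 - z')" "w (x1 - z') * w (x2 - z)" "f (z' - y2) * f (z - y1)" "f (z' - y1) * f (z - y2)"]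
          by (simp add: ac_simps)
      qed
    qed
    then show ?thesis
      by (subst (asm) ennreal_mult_le_mult_iff) auto
  qed
  then show ?thesis unfolding pf2_def by (auto simp: H_def[symmetric])
qed

text \<open>The iterated convolution of \<open>h\<close> with all \<open>f j\<close>. It is also an
  integral over the hyperplane where the entries add up to \<open>s\<close>: the entry determined by
  the others carries \<open>h\<close>.\<close>

definition multi_conv :: "'i set \<Rightarrow> ('i \<Rightarrow> real \<Rightarrow> ennreal) \<Rightarrow> (real \<Rightarrow> ennreal) \<Rightarrow> real \<Rightarrow> ennreal" where
  "multi_conv J f h s = (\<integral>\<^sup>+x. (\<Prod>j\<in>J. f j (x j)) * h (s - (\<Sum>j\<in>J. x j)) \<partial>(\<Pi>\<^sub>M j\<in>J. lborel))"

lemma multi_conv_insert: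
  assumes J: "finite J" "i \<notin> J" and f: "\<And>j. f j \<in> borel_measurable borel" and h: "h \<in> borel_measurable borel"
  shows "multi_conv (insert i J) f h s = (\<integral>\<^sup>+x. f i x * multi_conv J f h (s - x) \<partial>lborel)"
proof -
  interpret product_sigma_finite "\<lambda>_. lborel :: real measure" by standard
  note [measurable] = f h
  have "multi_conv (insert i J) f h s = (\<integral>\<^sup>+y. \<integral>\<^sup>+x. (\<Prod>j\<in>insert i J. f j ((x(i := y)) j)) *
      h (s - (\<Sum>j\<in>insert i J. (x(i := y)) j)) \<partial>(\<Pi>\<^sub>M j\<in>J. lborel) \<partial>lborel)"
    unfolding multi_conv_def using J by (intro product_nn_integral_insert_rev) auto
  also have "\<dots> = (\<integral>\<^sup>+y. f i y * multi_conv J f h (s - y) \<partial>lborel)"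
  proof (intro nn_integral_cong)
    fix y :: real
    have "(\<Prod>j\<in>insert i J. f j ((x(i := y)) j)) * h (s - (\<Sum>j\<in>insert i J. (x(i := y)) j))
      = f i y * ((\<Prod>j\<in>J. f j (x j)) * h (s - y - (\<Sum>j\<in>J. x j)))" for x
    proof -
      have "(\<Prod>j\<in>J. f j ((x(i := y)) j)) = (\<Prod>j\<in>J. f j (x j))" "(\<Sum>j\<in>J. (x(i := y)) j) = (\<Sum>j\<in>J. x j)"
        using J by (auto intro!: prod.cong sum.cong)
      then show ?thesis using J by (simp add: mult.assoc algebra_simps)
    qed
    then show "(\<integral>\<^sup>+x. (\<Prod>j\<in>insert i J. f j ((x(i := y)) j)) *
      h (s - (\<Sum>j\<in>insert i J. (x(i := y)) j)) \<partial>(\<Pi>\<^sub>M j\<in>J. lborel)) = f i y * multi_conv J f h (s - y)"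
      unfolding multi_conv_def by (simp add: nn_integral_cmult)
  qed
  finally show ?thesis .
qed

lemma pf2_multi_conv:
  assumes "finite J" "\<And>j. pf2 (f j)" "pf2 h"
  shows "pf2 (multi_conv J f h)"
  using assms(1)
proof induction
  case empty
  interpret product_sigma_finite "\<lambda>_. lborel :: real measure" by standard
  have "multi_conv {} f h = h"
    by (rule ext) (simp only: multi_conv_def sum.empty prod.empty diff_0_right mult_1 nn_integral_empty zero_le)
  then show ?case using assms by simp
next
  case (insert i J)
  have "multi_conv (insert i J) f h = (\<lambda>s. \<integral>\<^sup>+x. f i x * multi_conv J f h (s - x) \<partial>lborel)"
    using insert assms by (intro ext multi_conv_insert) (auto simp: pf2_def)
  then show ?case using pf2_convolution[OF assms(2) insert.IH] by simp
qed

definition half_normal :: "bool \<Rightarrow> real \<Rightarrow> ennreal" where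
  "half_normal b x = ennreal (std_normal_density x) * indicator (if b then {0<..} else {..<0}) x"

lemma borel_measurable_half_normal[measurable]: "half_normal b \<in> borel_measurable borel"
  unfolding half_normal_def by measurable

text \<open>The exponents on the two sides differ by \<open>(x2 - x1) * (y2 - y1)\<close>. The
  arguments on the right lie between those on the left, so they belong to the half line whenever the
  latter do.\<close>

lemma pf2_half_normal: "pf2 (half_normal b)"
  unfolding pf2_def
proof (intro conjI allI impI)
  fix x1 x2 y1 y2 :: real assume x: "x1 \<le> x2" and y: "y1 \<le> y2"
  show "half_normal b (x1 - y2) * half_normal b (x2 - y1) \<le> half_normal b (x1 - y1) * half_normal b (x2 - y2)"
  proof (cases "half_normal b (x1 - y2) * half_normal b (x2 - y1) = 0")
    case False
    then have s: "if b then x1 - y2 > 0 else x2 - y1 < 0"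
      by (auto simp: half_normal_def split: if_splits split_indicator_asm)
    then have hn: "half_normal b (x1 - y2) = ennreal (std_normal_density (x1 - y2))"
       "half_normal b (x2 - y1) = ennreal (std_normal_density (x2 - y1))"
       "half_normal b (x1 - y1) = ennreal (std_normal_density (x1 - y1))"
       "half_normal b (x2 - y2) = ennreal (std_normal_density (x2 - y2))"
      using x y False by (auto simp: half_normal_def split: if_splits)
    have "- ((x1 - y2)\<^sup>2 / 2) + - ((x2 - y1)\<^sup>2 / 2) \<le> - ((x1 - y1)\<^sup>2 / 2) + - ((x2 - y2)\<^sup>2 / 2)"
      using mult_nonneg_nonneg[of "x2 - x1" "y2 - y1"] x y by (simp add: power2_eq_square field_simps)
    then have "exp (- ((x1 - y2)\<^sup>2 / 2)) * exp (- ((x2 - y1)\<^sup>2 / 2)) \<le> exp (- ((x1 - y1)\<^sup>2 / 2)) * exp (- ((x2 - y2)\<^sup>2 / 2))"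
      by (simp flip: exp_add)
    then have "std_normal_density (x1 - y2) * std_normal_density (x2 - y1)
        \<le> std_normal_density (x1 - y1) * std_normal_density (x2 - y2)"
      by (simp add: std_normal_density_def divide_right_mono)
    then show ?thesis unfolding hn by (simp flip: ennreal_mult')
  next
    case True
    show ?thesis unfolding True by simp
  qed
qed measurable

definition mean :: "real ^ 'm::finite \<Rightarrow> real" where
  "mean x = (\<Sum>i\<in>UNIV. x $ i) / CARD('m)"

definition centered :: "real ^ 'm::finite \<Rightarrow> real ^ 'm" where
  "centered g = g - (\<chi> i. mean g)"

text \<open>Strict inequalities make the cones open and disjoint; for centered Gaussian vectors with
  at least two entries they miss only a null set.\<close>

definition sign_cone :: "('m::finite \<Rightarrow> bool) \<Rightarrow> (real ^ 'm) set" where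
  "sign_cone \<sigma> = {x. \<forall>i. if \<sigma> i then x $ i > 0 else x $ i < 0}"

text \<open>Used below to shift all coordinates in \<open>I\<close> by the common mean
  \<open>m\<close>.\<close>

lemma distr_PiM_lborel_translation:
  assumes I: "finite I"
  shows "distr (\<Pi>\<^sub>M i\<in>I. lborel) (\<Pi>\<^sub>M i\<in>I. lborel) (\<lambda>x. \<lambda>i\<in>I. x i + m) = (\<Pi>\<^sub>M i\<in>I. (lborel :: real measure))"
proof -
  interpret product_sigma_finite "\<lambda>_. lborel :: real measure" by standard
  show ?thesis
  proof (rule PiM_eqI[OF I])
    fix A assume "\<And>i. i \<in> I \<Longrightarrow> A i \<in> sets (lborel :: real measure)"
    then have A: "A i \<in> sets borel" if "i \<in> I" for i using that by simp
    have A': "(\<lambda>x. x + m) -` A i \<in> sets borel" if "i \<in> I" for i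
      using measurable_sets[of "\<lambda>x. x + m" borel borel "A i"] A[OF that] by simp
    have "(\<lambda>x. \<lambda>i\<in>I. x i + m) -` PiE I A \<inter> space (\<Pi>\<^sub>M i\<in>I. (lborel :: real measure)) = PiE I (\<lambda>i. (\<lambda>x. x + m) -` A i)"
      by (auto simp: space_PiM PiE_def Pi_def)
    then have "emeasure (distr (\<Pi>\<^sub>M i\<in>I. lborel) (\<Pi>\<^sub>M i\<in>I. lborel) (\<lambda>x. \<lambda>i\<in>I. x i + m)) (PiE I A)
      = emeasure (\<Pi>\<^sub>M i\<in>I. lborel) (PiE I (\<lambda>i. (\<lambda>x. x + m) -` A i))"
      using A I by (subst emeasure_distr) (auto intro!: sets_PiM_I_finite)
    also have "\<dots> = (\<Prod>i\<in>I. emeasure lborel ((\<lambda>x. x + m) -` A i))"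
      using A' I by (subst emeasure_PiM) auto
    also have "\<dots> = (\<Prod>i\<in>I. emeasure lborel (A i))"
    proof (intro prod.cong refl)
      fix i assume i: "i \<in> I"
      have "emeasure lborel (A i) = emeasure (distr lborel borel ((+) m)) (A i)"
        by (simp add: lborel_distr_plus)
      also have "\<dots> = emeasure lborel ((+) m -` A i)"
        using A[OF i] by (subst emeasure_distr) auto
      also have "(+) m = (\<lambda>x. x + m)" by (auto simp: add.commute)
      finally show "emeasure lborel ((\<lambda>x. x + m) -` A i) = emeasure lborel (A i)" by simp
    qed
    finally show "emeasure (distr (\<Pi>\<^sub>M i\<in>I. lborel) (\<Pi>\<^sub>M i\<in>I. lborel) (\<lambda>x. \<lambda>i\<in>I. x i + m)) (PiE I A)
      = (\<Prod>i\<in>I. emeasure lborel (A i))" .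
  qed simp
qed

text \<open>The arguments on the left form a vector with mean \<open>m\<close> whose deviations
  \<open>x i\<close> and \<open>- (\<Sum>i\<in>I. x i)\<close> add up to \<open>0\<close>. Hence the
  mixed terms cancel in the sum of squares, and the mean separates from the deviations.\<close>

lemma normal_density_mean_factor:
  fixes x :: "'i \<Rightarrow> real"
  assumes I: "finite I"
  shows "(\<Prod>i\<in>I. std_normal_density (x i + m)) * std_normal_density (m - (\<Sum>i\<in>I. x i))
    = exp (- (real (Suc (card I)) * m\<^sup>2 / 2)) * ((\<Prod>i\<in>I. std_normal_density (x i)) * std_normal_density (- (\<Sum>i\<in>I. x i)))"
proof -
  have d: "std_normal_density y = exp (- (y\<^sup>2 / 2)) / sqrt (2 * pi)" for y
    by (simp add: std_normal_density_def)
  define s where "s = (\<Sum>i\<in>I. x i)"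
  have "(\<Sum>i\<in>I. - ((x i + m)\<^sup>2 / 2)) = (\<Sum>i\<in>I. - ((x i)\<^sup>2 / 2)) - m * s - card I * m\<^sup>2 / 2"
    by (simp add: s_def power2_sum sum.distrib sum_negf sum_subtractf sum_distrib_left sum_divide_distrib[symmetric] add_divide_distrib
      algebra_simps)
  then have "(\<Sum>i\<in>I. - ((x i + m)\<^sup>2 / 2)) + - ((m - s)\<^sup>2 / 2)
     = - (real (Suc (card I)) * m\<^sup>2 / 2) + ((\<Sum>i\<in>I. - ((x i)\<^sup>2 / 2)) + - ((- s)\<^sup>2 / 2))"
    by (simp add: power2_eq_square field_simps)
  then have "exp ((\<Sum>i\<in>I. - ((x i + m)\<^sup>2 / 2)) + - ((m - s)\<^sup>2 / 2))
     = exp (- (real (Suc (card I)) * m\<^sup>2 / 2) + ((\<Sum>i\<in>I. - ((x i)\<^sup>2 / 2)) + - ((- s)\<^sup>2 / 2)))"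
    by simp
  then have "(\<Prod>i\<in>I. exp (- ((x i + m)\<^sup>2 / 2))) * exp (- ((m - s)\<^sup>2 / 2))
     = exp (- (real (Suc (card I)) * m\<^sup>2 / 2)) * ((\<Prod>i\<in>I. exp (- ((x i)\<^sup>2 / 2))) * exp (- ((- s)\<^sup>2 / 2)))"
    unfolding exp_add exp_sum[OF I] by (simp only: mult.assoc)
  then show ?thesis
    unfolding d s_def[symmetric] by (simp add: prod_dividef)
qed

text \<open>The deviations determine the signs, and the mean only contributes a factor common to all
  patterns. The chosen entry \<open>c\<close> is the one that the constraint expresses by the
  others. The value of the factor is left open, because it occurs squared on both sides of the
  inequality it is used for.\<close>

lemma emeasure_centered_sign_cone:
  fixes c :: "'m::finite"
  shows "\<exists>C. \<forall>\<sigma>. emeasure gauss {g. centered g \<in> sign_cone \<sigma>}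
    = C * multi_conv (UNIV - {c}) (\<lambda>i. half_normal (\<sigma> i)) (half_normal (\<sigma> c)) 0"
proof -
  interpret L: product_sigma_finite "\<lambda>_::'m. lborel :: real measure" by standard
  define I where "I = UNIV - {c}"
  have I: "finite I" "c \<notin> I" "UNIV = insert c I" by (auto simp: I_def)
  interpret F: finite_product_sigma_finite "\<lambda>_::'m. lborel :: real measure" I by standard (rule I)
  interpret P: pair_sigma_finite "\<Pi>\<^sub>M i\<in>I. (lborel :: real measure)" "lborel :: real measure" by standard
  define n where "n = real (CARD('m))"
  have n: "n > 0" "n = real (Suc (card I))" using I(1,2)
    by (auto simp: n_def) (subst I(3), simp)
  define S where "S b = (if b then {0<..} else {..<0::real})" for b
  have [measurable]: "S b \<in> sets borel" for b by (simp add: S_def)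
  define mu where "mu x = (\<Sum>i\<in>UNIV. x i) / n" for x :: "'m \<Rightarrow> real"
  define C where "C = ennreal n * (\<integral>\<^sup>+m. ennreal (exp (- (n * m\<^sup>2 / 2))) \<partial>lborel)"
  show ?thesis
  proof (intro exI allI)
    fix \<sigma> :: "'m \<Rightarrow> bool"
    let ?f = "\<lambda>x. \<Prod>i\<in>UNIV. ennreal (std_normal_density (x i)) * indicator (S (\<sigma> i)) (x i - mu x)"
    have [measurable]: "(\<lambda>x::real^'m. vec_nth x i) \<in> borel_measurable borel" for i :: 'm by (rule measurable_vec_nth')
    have mv: "(\<lambda>x. \<chi> i. x i) \<in> (\<Pi>\<^sub>M i\<in>(UNIV::'m set). (lborel::real measure)) \<rightarrow>\<^sub>M borel"
      using measurable_vec_lambda[where ?'a=real and ?'m='m]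
      by (subst measurable_cong_sets[OF sets_PiM_cong[OF refl] refl]) auto
    have ms[measurable]: "{g. centered g \<in> sign_cone \<sigma>} \<in> sets borel"
    proof -
      have "{g \<in> space borel. \<forall>i. if \<sigma> i then g $ i > mean g else g $ i < mean g} \<in> sets borel"
        unfolding mean_def by measurable
      then show ?thesis by (simp add: sign_cone_def centered_def cong: if_cong)
    qed
    have "emeasure gauss {g. centered g \<in> sign_cone \<sigma>}
      = (\<integral>\<^sup>+g. ennreal (std_normal_vec_density g) * indicator {g. centered g \<in> sign_cone \<sigma>} g \<partial>lborel)"
      unfolding gauss_def std_normal_vec_density_eq by (subst emeasure_density) auto
    also have "\<dots> = (\<integral>\<^sup>+g. ?f (vec_nth g) \<partial>lborel)"
    proof (intro nn_integral_cong)
      fix g :: "real ^ 'm"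
      have "(centered g \<in> sign_cone \<sigma>) \<longleftrightarrow> (\<forall>i. g $ i - mu (vec_nth g) \<in> S (\<sigma> i))"
        by (auto simp: sign_cone_def centered_def S_def mu_def mean_def n_def split: if_splits)
      then have "indicator {g. centered g \<in> sign_cone \<sigma>} g = (\<Prod>i\<in>UNIV. indicator (S (\<sigma> i)) (g $ i - mu (vec_nth g)) :: ennreal)"
        by (auto simp: indicator_def)
      then show "ennreal (std_normal_vec_density g) * indicator {g. centered g \<in> sign_cone \<sigma>} g = ?f (vec_nth g)"
        by (simp add: prod.distrib std_normal_vec_density_def prod_ennreal)
    qed
    also have "\<dots> = (\<integral>\<^sup>+x. ?f x \<partial>(\<Pi>\<^sub>M i\<in>UNIV. lborel))"
      by (subst lborel_vec, subst nn_integral_distr[OF mv]) (auto simp: mu_def)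
    also have "\<dots> = (\<integral>\<^sup>+x. \<integral>\<^sup>+y. ?f (x(c := y)) \<partial>lborel \<partial>(\<Pi>\<^sub>M i\<in>I. lborel))"
      by (subst (1) I(3), rule L.product_nn_integral_insert) (auto simp: I mu_def)
    \<comment> \<open>The coordinate \<open>c\<close> is replaced by the mean \<open>m\<close> of
      the whole vector; the factor \<open>n\<close> is the Jacobian of this substitution.\<close>
    also have "\<dots> = (\<integral>\<^sup>+x. ennreal n * (\<integral>\<^sup>+m. ?f (x(c := - (\<Sum>i\<in>I. x i) + n * m)) \<partial>lborel) \<partial>(\<Pi>\<^sub>M i\<in>I. lborel))"
    proof (intro nn_integral_cong)
      fix x :: "'m \<Rightarrow> real"
      have "(\<lambda>y. (x(c := y)) i) \<in> borel_measurable borel" for i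
        by (cases "i = c") auto
      note [measurable] = this
      have "(\<lambda>y. ?f (x(c := y))) \<in> borel_measurable borel"
        unfolding mu_def by measurable
      then show "(\<integral>\<^sup>+y. ?f (x(c := y)) \<partial>lborel) = ennreal n * (\<integral>\<^sup>+m. ?f (x(c := - (\<Sum>i\<in>I. x i) + n * m)) \<partial>lborel)"
        using nn_integral_real_affine[of "\<lambda>y. ?f (x(c := y))" n "- (\<Sum>i\<in>I. x i)"] n(1)
        by (simp only: abs_of_pos less_imp_neq[symmetric] not_False_eq_True)
    qed
    also have "\<dots> = (\<integral>\<^sup>+x. ennreal n * (\<integral>\<^sup>+m. (\<Prod>i\<in>I. ennreal (std_normal_density (x i)) * indicator (S (\<sigma> i)) (x i - m)) *
        (ennreal (std_normal_density (n * m - (\<Sum>i\<in>I. x i))) * indicator (S (\<sigma> c)) (n * m - (\<Sum>i\<in>I. x i) - m)) \<partial>lborel) \<partial>(\<Pi>\<^sub>M i\<in>I. lborel))"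
    proof (intro nn_integral_cong arg_cong2[where f="(*)"] refl)
      fix x :: "'m \<Rightarrow> real" and m :: real
      let ?x = "x(c := - (\<Sum>i\<in>I. x i) + n * m)"
      have eq: "?x i = x i" if "i \<in> I" for i using that I by auto
      have "mu ?x = (?x c + (\<Sum>i\<in>I. ?x i)) / n"
        unfolding mu_def by (subst I(3), subst sum.insert[OF I(1,2)]) simp
      also have "(\<Sum>i\<in>I. ?x i) = (\<Sum>i\<in>I. x i)" by (intro sum.cong eq refl)
      also have "?x c + (\<Sum>i\<in>I. x i) = n * m" by simp
      also have "n * m / n = m" using n(1) by simp
      finally have mu: "mu ?x = m" .
      have "?f ?x = (ennreal (std_normal_density (?x c)) * indicator (S (\<sigma> c)) (?x c - m)) *
         (\<Prod>i\<in>I. ennreal (std_normal_density (?x i)) * indicator (S (\<sigma> i)) (?x i - m))"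
        unfolding mu by (subst I(3), rule prod.insert[OF I(1,2)])
      also have "(\<Prod>i\<in>I. ennreal (std_normal_density (?x i)) * indicator (S (\<sigma> i)) (?x i - m)) = (\<Prod>i\<in>I. ennreal (std_normal_density (x i)) * indicator (S (\<sigma> i)) (x i - m))"
        by (intro prod.cong refl) (simp only: eq)
      also have "(ennreal (std_normal_density (?x c)) * indicator (S (\<sigma> c)) (?x c - m)) *
         (\<Prod>i\<in>I. ennreal (std_normal_density (x i)) * indicator (S (\<sigma> i)) (x i - m)) = (\<Prod>i\<in>I. ennreal (std_normal_density (x i)) * indicator (S (\<sigma> i)) (x i - m)) *
        (ennreal (std_normal_density (n * m - (\<Sum>i\<in>I. x i))) * indicator (S (\<sigma> c)) (n * m - (\<Sum>i\<in>I. x i) - m))"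
        by (simp add: mult.commute)
      finally show "?f ?x = (\<Prod>i\<in>I. ennreal (std_normal_density (x i)) * indicator (S (\<sigma> i)) (x i - m)) *
        (ennreal (std_normal_density (n * m - (\<Sum>i\<in>I. x i))) * indicator (S (\<sigma> c)) (n * m - (\<Sum>i\<in>I. x i) - m))" .
    qed
    also have "\<dots> = ennreal n * (\<integral>\<^sup>+x. (\<integral>\<^sup>+m. (\<Prod>i\<in>I. ennreal (std_normal_density (x i)) * indicator (S (\<sigma> i)) (x i - m)) *
        (ennreal (std_normal_density (n * m - (\<Sum>i\<in>I. x i))) * indicator (S (\<sigma> c)) (n * m - (\<Sum>i\<in>I. x i) - m)) \<partial>lborel) \<partial>(\<Pi>\<^sub>M i\<in>I. lborel))"
      by (rule nn_integral_cmult) measurable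
    also have "(\<integral>\<^sup>+x. (\<integral>\<^sup>+m. (\<Prod>i\<in>I. ennreal (std_normal_density (x i)) * indicator (S (\<sigma> i)) (x i - m)) *
        (ennreal (std_normal_density (n * m - (\<Sum>i\<in>I. x i))) * indicator (S (\<sigma> c)) (n * m - (\<Sum>i\<in>I. x i) - m)) \<partial>lborel) \<partial>(\<Pi>\<^sub>M i\<in>I. lborel))
      = (\<integral>\<^sup>+m. (\<integral>\<^sup>+x. (\<Prod>i\<in>I. ennreal (std_normal_density (x i)) * indicator (S (\<sigma> i)) (x i - m)) *
        (ennreal (std_normal_density (n * m - (\<Sum>i\<in>I. x i))) * indicator (S (\<sigma> c)) (n * m - (\<Sum>i\<in>I. x i) - m)) \<partial>(\<Pi>\<^sub>M i\<in>I. lborel)) \<partial>lborel)"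
      by (rule P.Fubini'[symmetric]) measurable
    also have "\<dots> = (\<integral>\<^sup>+m. ennreal (exp (- (n * m\<^sup>2 / 2))) * multi_conv I (\<lambda>i. half_normal (\<sigma> i)) (half_normal (\<sigma> c)) 0 \<partial>lborel)"
    proof (rule nn_integral_cong)
      fix m :: real
      let ?g = "\<lambda>x. (\<Prod>i\<in>I. ennreal (std_normal_density (x i)) * indicator (S (\<sigma> i)) (x i - m)) *
        (ennreal (std_normal_density (n * m - (\<Sum>i\<in>I. x i))) * indicator (S (\<sigma> c)) (n * m - (\<Sum>i\<in>I. x i) - m))"
      \<comment> \<open>After the shift by \<open>m\<close>, the variables are the deviations from
        the mean, and entry \<open>c\<close> has the deviation
        \<open>- (\<Sum>i\<in>I. x i)\<close>.\<close>
      have "(\<integral>\<^sup>+x. ?g x \<partial>(\<Pi>\<^sub>M i\<in>I. lborel)) = (\<integral>\<^sup>+x. ?g x \<partial>distr (\<Pi>\<^sub>M i\<in>I. lborel) (\<Pi>\<^sub>M i\<in>I. lborel) (\<lambda>x. \<lambda>i\<in>I. x i + m))"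
        by (simp only: distr_PiM_lborel_translation[OF I(1)])
      also have "\<dots> = (\<integral>\<^sup>+x. ?g (\<lambda>i\<in>I. x i + m) \<partial>(\<Pi>\<^sub>M i\<in>I. lborel))"
        by (rule nn_integral_distr) measurable
      also have "\<dots> = (\<integral>\<^sup>+x. ennreal (exp (- (n * m\<^sup>2 / 2))) *
          ((\<Prod>i\<in>I. half_normal (\<sigma> i) (x i)) * half_normal (\<sigma> c) (0 - (\<Sum>i\<in>I. x i))) \<partial>(\<Pi>\<^sub>M i\<in>I. lborel))"
      proof (rule nn_integral_cong)
        fix x :: "'m \<Rightarrow> real"
        have sum: "(\<Sum>i\<in>I. (\<lambda>i\<in>I. x i + m) i) = (\<Sum>i\<in>I. x i) + (n - 1) * m"
          by (simp add: sum.distrib n(2))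
        have prod: "(\<Prod>i\<in>I. ennreal (std_normal_density ((\<lambda>i\<in>I. x i + m) i)) * indicator (S (\<sigma> i)) ((\<lambda>i\<in>I. x i + m) i - m))
          = (\<Prod>i\<in>I. ennreal (std_normal_density (x i + m))) * (\<Prod>i\<in>I. indicator (S (\<sigma> i)) (x i))"
          by (simp add: prod.distrib)
        have "n * m - (\<Sum>i\<in>I. (\<lambda>i\<in>I. x i + m) i) = m - (\<Sum>i\<in>I. x i)"
          unfolding sum by (simp add: algebra_simps)
        then have "?g (\<lambda>i\<in>I. x i + m) = (\<Prod>i\<in>I. ennreal (std_normal_density (x i + m))) * (\<Prod>i\<in>I. indicator (S (\<sigma> i)) (x i)) *
           (ennreal (std_normal_density (m - (\<Sum>i\<in>I. x i))) * indicator (S (\<sigma> c)) (- (\<Sum>i\<in>I. x i)))"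
          unfolding prod by simp
        also have "\<dots> = ennreal ((\<Prod>i\<in>I. std_normal_density (x i + m)) * std_normal_density (m - (\<Sum>i\<in>I. x i))) *
           ((\<Prod>i\<in>I. indicator (S (\<sigma> i)) (x i)) * indicator (S (\<sigma> c)) (- (\<Sum>i\<in>I. x i)))"
          by (simp add: ennreal_mult prod_nonneg prod_ennreal ac_simps)
        also have "\<dots> = ennreal (exp (- (n * m\<^sup>2 / 2))) * (ennreal (\<Prod>i\<in>I. std_normal_density (x i)) * ennreal (std_normal_density (- (\<Sum>i\<in>I. x i)))) *
           ((\<Prod>i\<in>I. indicator (S (\<sigma> i)) (x i)) * indicator (S (\<sigma> c)) (- (\<Sum>i\<in>I. x i)))"
          unfolding normal_density_mean_factor[OF I(1)] n(2)[symmetric] by (simp add: ennreal_mult prod_nonneg)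
        also have "\<dots> = ennreal (exp (- (n * m\<^sup>2 / 2))) *
          ((\<Prod>i\<in>I. half_normal (\<sigma> i) (x i)) * half_normal (\<sigma> c) (0 - (\<Sum>i\<in>I. x i)))"
          unfolding half_normal_def S_def[symmetric] prod.distrib by (simp add: prod_ennreal ac_simps)
        finally show "?g (\<lambda>i\<in>I. x i + m) = ennreal (exp (- (n * m\<^sup>2 / 2))) *
          ((\<Prod>i\<in>I. half_normal (\<sigma> i) (x i)) * half_normal (\<sigma> c) (0 - (\<Sum>i\<in>I. x i)))" .
      qed
      also have "\<dots> = ennreal (exp (- (n * m\<^sup>2 / 2))) * multi_conv I (\<lambda>i. half_normal (\<sigma> i)) (half_normal (\<sigma> c)) 0"
        unfolding multi_conv_def by (rule nn_integral_cmult) measurable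
      finally show "(\<integral>\<^sup>+x. ?g x \<partial>(\<Pi>\<^sub>M i\<in>I. lborel)) = ennreal (exp (- (n * m\<^sup>2 / 2))) * multi_conv I (\<lambda>i. half_normal (\<sigma> i)) (half_normal (\<sigma> c)) 0" .
    qed
    also have "ennreal n * \<dots> = C * multi_conv I (\<lambda>i. half_normal (\<sigma> i)) (half_normal (\<sigma> c)) 0"
      unfolding C_def by (subst nn_integral_multc) (auto simp: mult.assoc)
    finally show "emeasure gauss {g. centered g \<in> sign_cone \<sigma>}
      = C * multi_conv (UNIV - {c}) (\<lambda>i. half_normal (\<sigma> i)) (half_normal (\<sigma> c)) 0"
      unfolding I_def .
  qed
qed

text \<open>Both products are fourfold integrals. Once \<open>y\<close> and \<open>y'\<close> have
  changed places in one of them, they contain the same half normal factors, and only the values of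
  \<open>w\<close> remain to be compared. The third index \<open>c\<close> takes up the constraint
  on the sum.\<close>

lemma emeasure_centered_sign_cone_exchange:
  fixes \<sigma> :: "'m::finite \<Rightarrow> bool"
  assumes ab: "a \<noteq> b" and card: "CARD('m) \<ge> 3"
  defines "q \<equiv> \<lambda>\<sigma>. emeasure gauss {g. centered g \<in> sign_cone \<sigma>}"
  shows "q (\<sigma>(a := True, b := True)) * q (\<sigma>(a := False, b := False))
    \<le> q (\<sigma>(a := True, b := False)) * q (\<sigma>(a := False, b := True))"
proof -
  have "\<exists>c. c \<notin> {a, b}"
  proof (rule ccontr)
    assume "\<nexists>c. c \<notin> {a, b}"
    then have "UNIV = {a, b}" by auto
    then have "CARD('m) \<le> 2" by (metis card_2_iff ab order_refl)
    then show False using card by simp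
  qed
  then obtain c where c: "c \<noteq> a" "c \<noteq> b" by auto
  obtain C where C: "\<And>\<sigma>. q \<sigma> = C * multi_conv (UNIV - {c}) (\<lambda>i. half_normal (\<sigma> i)) (half_normal (\<sigma> c)) 0"
    unfolding q_def using emeasure_centered_sign_cone by blast
  define J where "J = UNIV - {a, b, c}"
  have J: "UNIV - {c} = insert a (insert b J)" "finite J" "a \<notin> insert b J" "b \<notin> J" "c \<notin> J" "a \<notin> J"
    using c ab by (auto simp: J_def)
  define w where "w = multi_conv J (\<lambda>i. half_normal (\<sigma> i)) (half_normal (\<sigma> c))"
  have w: "pf2 w" unfolding w_def using J by (intro pf2_multi_conv pf2_half_normal)
  then have [measurable]: "w \<in> borel_measurable borel" by (simp add: pf2_def)
  have Z: "q (\<sigma>(a := s, b := t)) = C * (\<integral>\<^sup>+x. \<integral>\<^sup>+y. half_normal s x * half_normal t y * w (- x - y) \<partial>lborel \<partial>lborel)" for s t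
  proof -
    let ?\<sigma> = "\<sigma>(a := s, b := t)"
    have "multi_conv J (\<lambda>i. half_normal (?\<sigma> i)) (half_normal (?\<sigma> c)) u = w u" for u
      unfolding w_def multi_conv_def
      using J c by (intro nn_integral_cong arg_cong2[where f="(*)"] prod.cong) auto
    then have "multi_conv (UNIV - {c}) (\<lambda>i. half_normal (?\<sigma> i)) (half_normal (?\<sigma> c)) 0
      = (\<integral>\<^sup>+x. half_normal s x * (\<integral>\<^sup>+y. half_normal t y * w (- x - y) \<partial>lborel) \<partial>lborel)"
      using J ab by (simp add: multi_conv_insert)
    then show ?thesis by (simp add: C nn_integral_cmult mult.assoc)
  qed
  define D where "D s t = (\<integral>\<^sup>+x. \<integral>\<^sup>+y. half_normal s x * half_normal t y * w (- x - y) \<partial>lborel \<partial>lborel)" for s t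
  have DD: "D s t * D s' t' = (\<integral>\<^sup>+x. \<integral>\<^sup>+y. \<integral>\<^sup>+x'. \<integral>\<^sup>+y'. (half_normal s x * half_normal t y * w (- x - y)) *
     (half_normal s' x' * half_normal t' y' * w (- x' - y')) \<partial>lborel \<partial>lborel \<partial>lborel \<partial>lborel)" for s t s' t'
    unfolding D_def by (subst nn_integral_multc[symmetric], measurable)
      (intro nn_integral_cong, subst nn_integral_multc[symmetric], measurable,
       intro nn_integral_cong, subst nn_integral_cmult[symmetric], measurable,
       intro nn_integral_cong, subst nn_integral_cmult[symmetric], measurable)
  \<comment> \<open>Three exchanges of neighbouring integrals give the order \<open>x\<close>,
    \<open>y'\<close>, \<open>x'\<close>, \<open>y\<close>; renaming the bound variables is the
    desired change of places.\<close>
  have DD': "D s t * D s' t' = (\<integral>\<^sup>+x. \<integral>\<^sup>+y. \<integral>\<^sup>+x'. \<integral>\<^sup>+y'. (half_normal s x * half_normal t y' * w (- x - y')) *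
     (half_normal s' x' * half_normal t' y * w (- x' - y)) \<partial>lborel \<partial>lborel \<partial>lborel \<partial>lborel)" for s t s' t'
  proof -
    have "D s t * D s' t' = (\<integral>\<^sup>+x. \<integral>\<^sup>+y. \<integral>\<^sup>+x'. \<integral>\<^sup>+y'. (half_normal s x * half_normal t y * w (- x - y)) *
     (half_normal s' x' * half_normal t' y' * w (- x' - y')) \<partial>lborel \<partial>lborel \<partial>lborel \<partial>lborel)" by (rule DD)
    also have "\<dots> = (\<integral>\<^sup>+x. \<integral>\<^sup>+y. \<integral>\<^sup>+y'. \<integral>\<^sup>+x'. (half_normal s x * half_normal t y * w (- x - y)) *
     (half_normal s' x' * half_normal t' y' * w (- x' - y')) \<partial>lborel \<partial>lborel \<partial>lborel \<partial>lborel)"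
      by (intro nn_integral_cong lborel_pair.Fubini') measurable
    also have "\<dots> = (\<integral>\<^sup>+x. \<integral>\<^sup>+y'. \<integral>\<^sup>+y. \<integral>\<^sup>+x'. (half_normal s x * half_normal t y * w (- x - y)) *
     (half_normal s' x' * half_normal t' y' * w (- x' - y')) \<partial>lborel \<partial>lborel \<partial>lborel \<partial>lborel)"
      by (intro nn_integral_cong lborel_pair.Fubini') measurable
    also have "\<dots> = (\<integral>\<^sup>+x. \<integral>\<^sup>+y'. \<integral>\<^sup>+x'. \<integral>\<^sup>+y. (half_normal s x * half_normal t y * w (- x - y)) *
     (half_normal s' x' * half_normal t' y' * w (- x' - y')) \<partial>lborel \<partial>lborel \<partial>lborel \<partial>lborel)"
      by (intro nn_integral_cong lborel_pair.Fubini') measurable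
    finally show ?thesis .
  qed
  have "D True True * D False False \<le> D True False * D False True"
    unfolding DD[of True True] DD'[of True False]
  proof (intro nn_integral_mono)
    fix x y x' y' :: real
    show "half_normal True x * half_normal True y * w (- x - y) * (half_normal False x' * half_normal False y' * w (- x' - y'))
      \<le> half_normal True x * half_normal False y' * w (- x - y') * (half_normal False x' * half_normal True y * w (- x' - y))"
    proof (cases "x > 0 \<and> y > 0 \<and> x' < 0 \<and> y' < 0")
      case True
      then have "w (- x - y) * w (- x' - y') \<le> w (- x - y') * w (- x' - y)"
        using w[unfolded pf2_def, THEN conjunct2, rule_format, of "-x" "-x'" y' y] by (simp add: mult.commute)
      then have "(half_normal True x * half_normal True y * (half_normal False x' * half_normal False y')) * (w (- x - y) * w (- x' - y'))
        \<le> (half_normal True x * half_normal True y * (half_normal False x' * half_normal False y')) * (w (- x - y') * w (- x' - y))"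
        by (rule mult_left_mono) simp
      then show ?thesis by (simp add: ac_simps)
    next
      case False
      then have "half_normal True x * half_normal True y * w (- x - y) * (half_normal False x' * half_normal False y' * w (- x' - y')) = 0"
        by (auto simp: half_normal_def)
      then show ?thesis unfolding mult_eq_0_iff by (elim disjE) simp_all
    qed
  qed
  then have "(C * C) * (D True True * D False False) \<le> (C * C) * (D True False * D False True)"
    by (rule mult_left_mono) simp
  then show ?thesis unfolding Z D_def[symmetric] by (simp add: ac_simps)
qed

section \<open>Reflections and the projection along the all-ones vector\<close>

text \<open>The Householder reflection; for \<open>u = 0\<close> the division by zero makes it the
  identity, so no case distinction is needed.\<close>

definition reflect_along :: "'a::euclidean_space \<Rightarrow> 'a \<Rightarrow> 'a" where
  "reflect_along u x = x - (2 * (x \<bullet> u) / (u \<bullet> u)) *\<^sub>R u"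

lemma orthogonal_transformation_reflect_along: "orthogonal_transformation (reflect_along u)"
  unfolding orthogonal_transformation_def
proof (intro conjI allI)
  show "linear (reflect_along u)"
    by (rule linearI) (auto simp: reflect_along_def inner_add_left algebra_simps add_divide_distrib)
  show "reflect_along u x \<bullet> reflect_along u y = x \<bullet> y" for x y
    by (cases "u = 0") (auto simp: reflect_along_def inner_diff inner_commute field_simps)
qed

lemma reflect_along_orthogonal: "x \<bullet> u = 0 \<Longrightarrow> reflect_along u x = x"
  by (simp add: reflect_along_def)

text \<open>For equal norms \<open>2 * (y \<bullet> (y - z)) = (y - z) \<bullet> (y - z)\<close>, so
  exactly \<open>y - z\<close> is subtracted.\<close>

lemma reflect_along_swap:
  assumes "norm y = norm z"
  shows "reflect_along (y - z) y = z"
proof (cases "y = z")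
  case False
  have yz: "y \<bullet> y = z \<bullet> z" using assms by (simp add: norm_eq)
  then have "2 * (y \<bullet> (y - z)) = (y - z) \<bullet> (y - z)"
    by (simp add: inner_diff inner_commute)
  moreover have "(y - z) \<bullet> (y - z) \<noteq> 0" using False by simp
  ultimately have *: "2 * (y \<bullet> (y - z)) / ((y - z) \<bullet> (y - z)) = 1" by (metis divide_self)
  show ?thesis unfolding reflect_along_def * by simp
qed (simp add: reflect_along_def)

lemma mean_eq_inner: "mean g = (g \<bullet> 1) / CARD('m)" for g :: "real ^ 'm::finite"
  by (simp add: mean_def inner_vec_def)

text \<open>This exhibits \<open>centered\<close> as the orthogonal projection onto the complement
  of the all-ones vector \<open>1\<close>.\<close>

lemma centered_eq: "centered g = g - (g \<bullet> 1 / CARD('m)) *\<^sub>R 1" for g :: "real ^ 'm::finite"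
  by (simp add: centered_def mean_eq_inner vec_eq_iff)

lemma one_inner_one: "(1 :: real ^ 'm::finite) \<bullet> 1 = CARD('m)"
  by (simp add: inner_vec_def)

lemma centered_inner_one: "centered g \<bullet> 1 = 0"
  by (simp add: centered_eq inner_diff_left one_inner_one)

lemma centered_fixed: "g \<bullet> 1 = 0 \<Longrightarrow> centered g = g"
  by (simp add: centered_eq)

lemma continuous_centered: "continuous_on S centered"
  unfolding centered_eq by (intro continuous_intros) auto

lemma borel_measurable_centered[measurable]: "centered \<in> borel_measurable borel"
  by (intro borel_measurable_continuous_onI continuous_centered)

lemma borel_measurable_centered_gauss[measurable]: "centered \<in> borel_measurable gauss"
  by (simp add: measurable_cong_sets[OF sets_gauss refl])

text \<open>An isometry that fixes \<open>1\<close> preserves the inner product with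
  \<open>1\<close>, and with it the mean.\<close>

lemma centered_orthogonal_transformation:
  fixes f :: "real ^ 'm::finite \<Rightarrow> real ^ 'm"
  assumes f: "orthogonal_transformation f" "f 1 = 1"
  shows "centered (f g) = f (centered g)"
proof -
  have "f g \<bullet> 1 = g \<bullet> 1" using f by (metis orthogonal_transformation_def)
  moreover have "linear f" using f by (simp add: orthogonal_transformation_def)
  ultimately show ?thesis
    by (simp add: centered_eq linear_diff linear_scale f(2))
qed

lemma emeasure_gauss_orthogonal:
  fixes T :: "'a::euclidean_space \<Rightarrow> 'a"
  assumes T: "orthogonal_transformation T" and A: "A \<in> sets borel"
  shows "emeasure gauss (T -` A) = emeasure gauss A"
proof -
  have [measurable]: "T \<in> borel_measurable borel"
    using T by (intro borel_measurable_continuous_onI linear_continuous_on)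
       (auto simp: orthogonal_transformation linear_conv_bounded_linear)
  have "emeasure gauss A = emeasure (distr gauss borel T) A"
    by (simp add: distr_gauss_orthogonal[OF T])
  also have "\<dots> = emeasure gauss (T -` A)"
    using A by (subst emeasure_distr) auto
  finally show ?thesis by simp
qed

lemma gauss_hyperplane:
  fixes a :: "'a::euclidean_space"
  assumes "a \<noteq> 0"
  shows "AE x in gauss. a \<bullet> x \<noteq> 0"
proof -
  have c: "{x. a \<bullet> x = 0} \<in> sets borel"
    by (intro borel_closed closed_hyperplane)
  have "negligible {x. a \<bullet> x = 0}" using assms by (intro negligible_hyperplane) auto
  then have "emeasure lborel {x. a \<bullet> x = 0} = 0"
    using c by (simp add: negligible_iff_emeasure0)
  then have "emeasure gauss {x. a \<bullet> x = 0} = 0"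
    using c by (simp add: emeasure_gauss_eq_0_iff)
  then show ?thesis using c by (intro AE_I[of _ _ "{x. a \<bullet> x = 0}"]) auto
qed

lemma gauss_open_pos:
  assumes "open A" "A \<noteq> {}"
  shows "emeasure gauss A \<noteq> 0"
proof -
  have "\<not> negligible A" using assms by (rule open_not_negligible)
  then show ?thesis using assms
    by (auto simp: emeasure_gauss_eq_0_iff negligible_iff_emeasure0)
qed

section \<open>The affine dependence of Gaussian points\<close>

text \<open>The points are the rows of \<open>W\<close>; the type \<open>'d option option\<close> serves as index set because it
  has \<open>CARD('d) + 2\<close> elements. The cofactor vector \<open>dep W\<close> spans the orthogonal complement of \<open>1\<close> and
  the columns of \<open>W\<close>, unless these are linearly dependent, in which case it vanishes.\<close>

definition dep_matrix :: "real ^ ('d option option) \<Rightarrow> real ^ 'd ^ ('d::finite option option) \<Rightarrow> real ^ ('d option option) ^ ('d option option)" where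
  "dep_matrix v W = (\<chi> k. case k of None \<Rightarrow> v | Some None \<Rightarrow> 1 | Some (Some j) \<Rightarrow> column j W)"

definition dep :: "real ^ 'd ^ ('d::finite option option) \<Rightarrow> real ^ ('d option option)" where
  "dep W = (\<chi> i. det (dep_matrix (axis i 1) W))"

text \<open>Expansion along the row \<open>None\<close>, by multilinearity. Orthogonality of
  \<open>dep W\<close> to \<open>1\<close> and to the columns of \<open>W\<close> thereby becomes
  the vanishing of determinants with two equal rows.\<close>

lemma det_dep_matrix: "det (dep_matrix v W) = dep W \<bullet> v"
proof -
  let ?c = "\<lambda>k. case k of None \<Rightarrow> 0 | Some None \<Rightarrow> 1 | Some (Some j) \<Rightarrow> column j W"
  have M: "dep_matrix u W = (\<chi> k. if k = None then u else ?c k)" for u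
    by (auto simp: dep_matrix_def vec_eq_iff split: option.splits)
  have v: "(\<Sum>i\<in>UNIV. v $ i *s axis i 1) = v" by (simp add: basis_expansion)
  then have "det (dep_matrix v W) = det (\<chi> k. if k = None then (\<Sum>i\<in>UNIV. v $ i *s axis i 1) else ?c k)"
    by (simp only: M v)
  also have "\<dots> = (\<Sum>i\<in>UNIV. det (\<chi> k. if k = None then v $ i *s axis i 1 else ?c k))"
    by (rule det_linear_row_sum) simp
  also have "\<dots> = (\<Sum>i\<in>UNIV. v $ i * det (\<chi> k. if k = None then axis i 1 else ?c k))"
    by (intro sum.cong refl det_row_mul)
  also have "\<dots> = dep W \<bullet> v"
    by (simp add: dep_def M inner_vec_def mult.commute)
  finally show ?thesis .
qed

lemma dep_inner_one: "dep W \<bullet> 1 = 0"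
  unfolding det_dep_matrix[symmetric]
  by (rule det_identical_rows[of None "Some None"]) (auto simp: dep_matrix_def row_def vec_eq_iff)

lemma dep_inner_column: "dep W \<bullet> column j W = 0"
  unfolding det_dep_matrix[symmetric]
  by (rule det_identical_rows[of None "Some (Some j)"]) (auto simp: dep_matrix_def row_def vec_eq_iff)

text \<open>The isometry mixes the points: it acts on each column, the vector of one coordinate of
  all points.\<close>

definition map_columns :: "(real ^ 'm \<Rightarrow> real ^ 'm) \<Rightarrow> real ^ 'd ^ 'm \<Rightarrow> real ^ 'd ^ 'm::finite" where
  "map_columns f W = (\<chi> i j. f (column j W) $ i)"

lemma column_map_columns: "column j (map_columns f W) = f (column j W)"
  by (simp add: map_columns_def column_def vec_eq_iff)

lemma inner_columns: "W \<bullet> W' = (\<Sum>j\<in>UNIV. column j W \<bullet> column j W')" for W :: "real ^ 'd::finite ^ 'm::finite"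
  unfolding inner_vec_def column_def by (subst sum.swap) simp

lemma orthogonal_transformation_map_columns:
  assumes f: "orthogonal_transformation f"
  shows "orthogonal_transformation (map_columns f)"
proof -
  have lin: "linear f" using f by (simp add: orthogonal_transformation_def)
  have c: "column j (x + y) = column j x + column j y" "column j (c *\<^sub>R x) = c *\<^sub>R column j x" for j c and x y :: "real ^ 'd ^ 'm"
    by (auto simp: column_def vec_eq_iff)
  show ?thesis
    unfolding orthogonal_transformation_def
    using f by (auto simp: inner_columns column_map_columns orthogonal_transformation_def
      intro!: linearI) (auto simp: map_columns_def vec_eq_iff c linear_add[OF lin] linear_scale[OF lin])
qed

text \<open>Because \<open>f\<close> fixes \<open>1\<close>, it acts on all rows of
  \<open>dep_matrix\<close> simultaneously, which is multiplication by
  \<open>transpose (matrix f)\<close>. The determinant is \<open>1\<close> or \<open>-1\<close>, so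
  \<open>f\<close> carries the line of \<open>dep W\<close> along, while the vector may change
  sign.\<close>

lemma dep_map_columns:
  assumes f: "orthogonal_transformation f" "f 1 = 1"
  shows "dep (map_columns f W) = det (matrix f) *\<^sub>R f (dep W)"
proof -
  have lin: "linear f" using f by (simp add: orthogonal_transformation_def)
  have "dep (map_columns f W) \<bullet> f v = (det (matrix f) *\<^sub>R f (dep W)) \<bullet> f v" for v
  proof -
    have "dep_matrix (f v) (map_columns f W) = (\<chi> k. f (dep_matrix v W $ k))"
      by (auto simp: dep_matrix_def vec_eq_iff column_map_columns f(2) split: option.splits)
    also have "\<dots> = dep_matrix v W ** transpose (matrix f)"
    proof -
      have "f u $ i = (\<Sum>k\<in>UNIV. u $ k * matrix f $ i $ k)" for u i
        by (subst fun_cong[OF matrix_vector_mul(2)[OF lin], of u, symmetric])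
          (simp add: matrix_vector_mult_def mult.commute)
      then show ?thesis
        by (simp add: matrix_matrix_mult_def vec_eq_iff transpose_def)
    qed
    finally have "det (dep_matrix (f v) (map_columns f W)) = det (matrix f) * det (dep_matrix v W)"
      by (simp add: det_mul)
    then show ?thesis
      using f by (simp add: det_dep_matrix orthogonal_transformation_def)
  qed
  moreover have "surj f" using f(1) by (rule orthogonal_transformation_surj)
  ultimately have "dep (map_columns f W) \<bullet> u = (det (matrix f) *\<^sub>R f (dep W)) \<bullet> u" for u
    by (metis surjD)
  then show ?thesis by (metis vector_eq_rdot)
qed

lemma continuous_det:
  fixes A :: "'a::topological_space \<Rightarrow> real ^ 'n ^ 'n::finite"
  assumes "\<And>i j. continuous_on S (\<lambda>x. A x $ i $ j)"
  shows "continuous_on S (\<lambda>x. det (A x))"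
  unfolding det_def by (intro continuous_intros assms)

lemma continuous_dep: "continuous_on S dep"
  unfolding dep_def
proof (intro continuous_on_vec_lambda continuous_det)
  fix i k l :: "'a option option"
  show "continuous_on S (\<lambda>W. dep_matrix (axis i 1) W $ k $ l)"
    by (cases k; cases "the k") (auto simp: dep_matrix_def column_def intro!: continuous_intros)
qed

lemma borel_measurable_dep[measurable]: "dep \<in> borel_measurable borel"
  by (intro borel_measurable_continuous_onI continuous_dep)

lemma borel_measurable_dep_gauss[measurable]: "dep \<in> borel_measurable gauss"
  by (simp add: measurable_cong_sets[OF sets_gauss refl])

text \<open>The conditions on \<open>x\<close> say that all rows of
  \<open>dep_matrix (axis a 1) W\<close> annihilate it, and the determinant of this matrix is
  \<open>dep W $ a\<close>.\<close>

lemma dep_matrix_mult_0D: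
  assumes "dep W $ a \<noteq> 0" "x $ a = 0" "x \<bullet> 1 = 0" "\<And>j. x \<bullet> column j W = 0"
  shows "x = 0"
proof -
  have "dep_matrix (axis a 1) W *v x = 0"
    unfolding vec_eq_iff
  proof
    fix k
    have "(dep_matrix (axis a 1) W *v x) $ k = dep_matrix (axis a 1) W $ k \<bullet> x"
      by (simp add: matrix_vector_mult_def inner_vec_def)
    also have "\<dots> = 0"
      using assms by (auto simp: dep_matrix_def inner_axis inner_commute[of _ x] split: option.splits)
    finally show "(dep_matrix (axis a 1) W *v x) $ k = 0 $ k" by simp
  qed
  moreover have "invertible (dep_matrix (axis a 1) W)"
    using assms(1) by (simp add: dep_def invertible_det_nz)
  ultimately show ?thesis
    by (metis invertible_def matrix_left_invertible_ker)
qed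

text \<open>Integrate the indicator of \<open>Z\<close> at \<open>x + t *\<^sub>R v\<close> over
  \<open>x\<close> and \<open>t\<close>. One order gives the measure of \<open>Z\<close> times the
  infinite length of the line; the other gives \<open>0\<close>, since countable sets are
  null.\<close>

lemma lborel_null_set_line:
  fixes Z :: "'a::euclidean_space set"
  assumes Z: "Z \<in> sets borel" and line: "\<And>x. countable {t::real. x + t *\<^sub>R v \<in> Z}"
  shows "emeasure lborel Z = 0"
proof -
  note [measurable] = Z
  have "(\<integral>\<^sup>+t. emeasure lborel Z \<partial>(lborel :: real measure)) = (\<integral>\<^sup>+t. (\<integral>\<^sup>+x. indicator Z (x + t *\<^sub>R v) \<partial>lborel) \<partial>lborel)"
  proof (rule nn_integral_cong)
    fix t :: real
    have "emeasure lborel Z = (\<integral>\<^sup>+x. indicator Z x \<partial>distr lborel borel ((+) (t *\<^sub>R v)))"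
      by (simp add: lborel_distr_plus)
    also have "\<dots> = (\<integral>\<^sup>+x. indicator Z (x + t *\<^sub>R v) \<partial>lborel)"
      by (subst nn_integral_distr) (auto simp: add.commute)
    finally show "emeasure lborel Z = (\<integral>\<^sup>+x. indicator Z (x + t *\<^sub>R v) \<partial>lborel)" .
  qed
  also have "\<dots> = (\<integral>\<^sup>+x. (\<integral>\<^sup>+t. indicator Z (x + t *\<^sub>R v) \<partial>lborel) \<partial>lborel)"
    by (rule lborel_pair.Fubini') measurable
  also have "\<dots> = (\<integral>\<^sup>+x. 0 \<partial>(lborel :: 'a measure))"
  proof (rule nn_integral_cong)
    fix x
    have "emeasure lborel {t::real. x + t *\<^sub>R v \<in> Z} = 0"
      using line by (rule emeasure_lborel_countable)
    moreover have "{t::real. x + t *\<^sub>R v \<in> Z} \<in> sets borel" by measurable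
    moreover have "(\<integral>\<^sup>+t. indicator Z (x + t *\<^sub>R v) \<partial>lborel) = (\<integral>\<^sup>+t. indicator {t. x + t *\<^sub>R v \<in> Z} t \<partial>lborel)"
      by (intro nn_integral_cong) (auto simp: indicator_def)
    ultimately show "(\<integral>\<^sup>+t. indicator Z (x + t *\<^sub>R v) \<partial>lborel) = 0"
      by simp
  qed
  finally show ?thesis by simp
qed

text \<open>The determinant is a polynomial in \<open>s\<close> whose value at \<open>0\<close> is
  \<open>det B\<close>, so it is not the zero polynomial.\<close>

lemma finite_zeros_det_pencil:
  fixes A B :: "real ^ 'n ^ 'n::finite"
  assumes "det B \<noteq> 0"
  shows "finite {s. det (s *\<^sub>R A + B) = 0}"
proof -
  define P where "P = det (\<chi> i j. [:B $ i $ j, A $ i $ j:])"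
  have P: "poly P s = det (s *\<^sub>R A + B)" for s
    by (simp add: P_def det_def poly_sum poly_prod algebra_simps)
  then have "P \<noteq> 0" using assms by (metis add_0 poly_0 scaleR_zero_left)
  then show ?thesis using poly_roots_finite[of P] by (simp add: P)
qed

text \<open>The first entry of \<open>dep (W + t *\<^sub>R W0)\<close> is, up to the substitution \<open>s = inverse t\<close> and a power of
  \<open>t\<close>, a polynomial in \<open>s\<close> that does not vanish at \<open>s = 0\<close>.\<close>

lemma gauss_dep_nonzero:
  "AE W in gauss. dep W \<noteq> (0 :: real ^ ('d::finite option option))"
proof -
  let ?e = "axis None 1 :: real ^ ('d option option)"
  \<comment> \<open>The points of \<open>W0\<close> are the origin, twice, and the standard basis
    vectors. Their dependence is the difference of the two copies of the origin, whose entry at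
    \<open>None\<close> is not zero.\<close>
  define W0 :: "real ^ 'd ^ ('d option option)" where "W0 = (\<chi> i j. if i = Some (Some j) then 1 else 0)"
  have W0: "det (dep_matrix ?e W0) \<noteq> 0"
  proof -
    have "x = 0" if "dep_matrix ?e W0 *v x = 0" for x
    proof -
      have k: "dep_matrix ?e W0 $ k \<bullet> x = 0" for k
        using arg_cong[OF that, of "\<lambda>y. y $ k"] by (simp add: matrix_vector_mult_def inner_vec_def)
      have "x $ None = 0" using k[of None] by (simp add: dep_matrix_def inner_axis')
      moreover have j: "x $ Some (Some j) = 0" for j
      proof -
        have "column j W0 = axis (Some (Some j)) 1" by (simp add: column_def W0_def axis_def vec_eq_iff)
        then show ?thesis using k[of "Some (Some j)"] by (simp add: dep_matrix_def inner_axis')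
      qed
      moreover have "x $ Some None = 0"
      proof -
        have "0 = (\<Sum>i\<in>UNIV. x $ i)" using k[of "Some None"] by (simp add: dep_matrix_def inner_vec_def)
        also have "\<dots> = (\<Sum>i\<in>{Some None}. x $ i)"
        proof (rule sum.mono_neutral_right)
          show "\<forall>i\<in>UNIV - {Some None}. x $ i = 0"
          proof
            fix i assume "i \<in> UNIV - {Some (None :: 'd option)}"
            then show "x $ i = 0" using \<open>x $ None = 0\<close> j by (cases i; cases "the i") auto
          qed
        qed auto
        finally show ?thesis by simp
      qed
      ultimately show "x = 0" unfolding vec_eq_iff by (metis option.exhaust zero_index)
    qed
    then have "invertible (dep_matrix ?e W0)"
      by (metis invertible_left_inverse matrix_left_invertible_ker)
    then show ?thesis by (simp add: invertible_det_nz)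
  qed
  define Z where "Z = {W :: real ^ 'd ^ ('d option option). det (dep_matrix ?e W) = 0}"
  have Zeq: "Z = {W. dep W \<bullet> ?e = 0}" by (simp add: Z_def det_dep_matrix)
  have Zb: "Z \<in> sets borel"
  proof -
    have "{W \<in> space borel. dep W \<bullet> ?e = 0} \<in> sets borel" by measurable
    then show ?thesis by (simp add: Zeq)
  qed
  have "emeasure lborel Z = 0"
  proof (rule lborel_null_set_line[OF Zb])
    fix W :: "real ^ 'd ^ ('d option option)"
    define A :: "real ^ ('d option option) ^ ('d option option)"
      \<comment> \<open>Zero in the rows \<open>None\<close> and \<open>Some None\<close>, since
        these rows of \<open>dep_matrix\<close> do not change with \<open>t\<close>; only the other
        rows are divided by \<open>t\<close>.\<close>
      where "A = (\<chi> k. case k of Some (Some j) \<Rightarrow> column j W | _ \<Rightarrow> 0)"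
    have fin: "finite {s. det (s *\<^sub>R A + dep_matrix ?e W0) = 0}"
      by (rule finite_zeros_det_pencil[OF W0])
    \<comment> \<open>The substitution \<open>s = inverse t\<close> says nothing about
      \<open>t = 0\<close>, so this value is added by hand.\<close>
    have "{t. W + t *\<^sub>R W0 \<in> Z} \<subseteq> insert 0 (inverse ` {s. det (s *\<^sub>R A + dep_matrix ?e W0) = 0})"
    proof
      fix t assume t: "t \<in> {t. W + t *\<^sub>R W0 \<in> Z}"
      show "t \<in> insert 0 (inverse ` {s. det (s *\<^sub>R A + dep_matrix ?e W0) = 0})"
      proof (cases "t = 0")
        case False
        define c :: "'d option option \<Rightarrow> real" where "c k = (case k of Some (Some j) \<Rightarrow> t | _ \<Rightarrow> 1)" for k
        have eq: "dep_matrix ?e (W + t *\<^sub>R W0) = (\<chi> k. c k *s (inverse t *\<^sub>R A + dep_matrix ?e W0) $ k)"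
          unfolding vec_eq_iff
        proof (intro allI)
          fix k i :: "'d option option"
          consider "k = None" | "k = Some None" | j where "k = Some (Some j)"
            by (metis option.exhaust)
          then show "dep_matrix ?e (W + t *\<^sub>R W0) $ k $ i = (\<chi> k. c k *s (inverse t *\<^sub>R A + dep_matrix ?e W0) $ k) $ k $ i"
            using False by cases (simp_all add: dep_matrix_def A_def c_def column_def field_simps)
        qed
        have "det (dep_matrix ?e (W + t *\<^sub>R W0)) = prod c UNIV * det (inverse t *\<^sub>R A + dep_matrix ?e W0)"
          unfolding eq by (subst det_rows_mul) (simp only: vec_lambda_eta)
        moreover have "prod c UNIV \<noteq> 0"
          using False by (simp add: prod_zero_iff c_def split: option.split)
        ultimately have "inverse t \<in> {s. det (s *\<^sub>R A + dep_matrix ?e W0) = 0}"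
          using t by (simp add: Z_def)
        then show ?thesis by (intro insertI2 image_eqI[of _ _ "inverse t"]) auto
      qed simp
    qed
    then have "finite {t. W + t *\<^sub>R W0 \<in> Z}" using fin by (meson finite_imageI finite_insert finite_subset)
    then show "countable {t. W + t *\<^sub>R W0 \<in> Z}" by (rule countable_finite)
  qed
  then have "emeasure gauss Z = 0" using Zb by (simp add: emeasure_gauss_eq_0_iff)
  then show ?thesis using Zb by (intro AE_I[of _ _ Z]) (auto simp: Zeq)
qed

text \<open>Each entry is the inner product of \<open>g\<close> with the projection of a unit
  vector, which is nonzero when there are at least two coordinates; hyperplanes are null
  sets.\<close>

lemma gauss_centered_nonzero:
  assumes "CARD('m::finite) \<ge> 2"
  shows "AE g :: real ^ 'm in gauss. \<forall>i. centered g $ i \<noteq> 0" and "AE g in gauss. centered g \<noteq> (0 :: real ^ 'm)"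
proof -
  have "AE g in gauss. centered g $ i \<noteq> 0" for i :: 'm
  proof -
    let ?a = "centered (axis i 1) :: real ^ 'm"
    have "?a $ i \<noteq> 0" using assms
      by (simp add: centered_eq inner_axis')
    then have "?a \<noteq> 0" by (metis zero_index)
    moreover have "centered g $ i = ?a \<bullet> g" for g
      by (simp add: centered_eq inner_diff_left inner_axis' inner_commute[of 1])
    ultimately show ?thesis using gauss_hyperplane[of ?a] by simp
  qed
  then show "AE g in gauss. \<forall>i::'m. centered g $ i \<noteq> 0" by (simp add: AE_all_countable)
  then show "AE g in gauss. centered g \<noteq> (0 :: real ^ 'm)"
    by eventually_elim auto
qed

text \<open>For unit vectors \<open>y\<close>, \<open>z\<close> orthogonal to \<open>1\<close>, the
  reflection along \<open>y - z\<close> fixes \<open>1\<close> and carries the cap around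
  \<open>y\<close> to the cap around \<open>z\<close>. Both \<open>dep\<close> and
  \<open>centered\<close> commute with it up to sign, so both laws give equal mass to equal caps and
  the uniqueness on lines applies.\<close>

lemma emeasure_dep_eq_centered:
  fixes U :: "(real ^ ('d::finite option option)) set"
  assumes U: "open U" "\<And>c x. x \<in> U \<Longrightarrow> c \<noteq> 0 \<Longrightarrow> c *\<^sub>R x \<in> U"
  shows "emeasure gauss {W. dep W \<in> U} = emeasure gauss {g. centered g \<in> U}"
proof -
  define V :: "(real ^ ('d option option)) set" where "V = {x. x \<bullet> 1 = 0}"
  interpret G1: prob_space "gauss :: (real ^ 'd ^ ('d option option)) measure" by (rule prob_space_gauss)
  interpret G2: prob_space "gauss :: (real ^ ('d option option)) measure" by (rule prob_space_gauss)
  define K where "K r y = {x :: real ^ ('d option option). \<bar>x \<bullet> y\<bar> > r * norm x}" for r y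
  have "open (K r y)" for r y
    unfolding K_def by (intro open_Collect_less continuous_intros)
  then have K[measurable]: "K r y \<in> sets borel" for r y by auto
  have refl1: "reflect_along (y - z) 1 = 1" if "y \<in> V" "z \<in> V" for y z
    using that by (intro reflect_along_orthogonal) (simp add: V_def inner_diff_right inner_commute)
  have reflK: "reflect_along (y - z) -` K r z = K r y" if "norm y = 1" "norm z = 1" for r y z
  proof -
    have "reflect_along (y - z) x \<bullet> z = x \<bullet> y" for x
      using orthogonal_transformation_reflect_along[of "y - z"] reflect_along_swap[of y z] that
      by (metis orthogonal_transformation_def)
    moreover have "norm (reflect_along (y - z) x) = norm x" for x
      using orthogonal_transformation_reflect_along by (rule orthogonal_transformation_norm)
    ultimately show ?thesis by (auto simp: K_def)
  qed
  have card: "CARD('d option option) \<ge> 2" by simp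
  have "emeasure (distr gauss borel dep) U = emeasure (distr gauss borel centered) U"
  proof (rule isotropic_measures_eq[where V=V])
    show "prob_space (distr gauss borel dep)" using prob_space_gauss by (rule prob_space.prob_space_distr) simp
    show "prob_space (distr gauss borel centered)" using prob_space_gauss by (rule prob_space.prob_space_distr) simp
    show "AE x in distr gauss borel dep. x \<in> V \<and> x \<noteq> 0"
      using gauss_dep_nonzero
      by (subst AE_distr_iff) (auto simp: V_def dep_inner_one)
    show "AE x in distr gauss borel centered. x \<in> V \<and> x \<noteq> 0"
      using gauss_centered_nonzero(2)[OF card]
      by (subst AE_distr_iff) (auto simp: V_def centered_inner_one)
    show "c *\<^sub>R x \<in> V" if "x \<in> V" for c x using that by (simp add: V_def)
  next
    fix r y z assume yz: "y \<in> V" "z \<in> V" "norm y = 1" "norm z = 1"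
    let ?f = "reflect_along (y - z)"
    have f: "orthogonal_transformation ?f" by (rule orthogonal_transformation_reflect_along)
    \<comment> \<open>Caps are symmetric, which absorbs the sign
      \<open>det (matrix ?f)\<close>.\<close>
    have Kscale: "c *\<^sub>R x \<in> K r z \<longleftrightarrow> x \<in> K r z" if "\<bar>c\<bar> = 1" for c x
      using that by (simp add: K_def abs_mult)
    have "\<bar>det (matrix ?f)\<bar> = 1"
      using orthogonal_transformation_det[OF f] .
    then have "map_columns ?f -` (dep -` K r z) = dep -` K r y"
      using reflK[OF yz(3,4), of r] by (auto simp: dep_map_columns[OF f refl1[OF yz(1,2)]] Kscale)
    then have "emeasure gauss (dep -` K r y) = emeasure gauss (dep -` K r z)"
      using emeasure_gauss_orthogonal[OF orthogonal_transformation_map_columns[OF f], of "dep -` K r z"]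
        measurable_sets[OF borel_measurable_dep K, of r z] by simp
    then show "emeasure (distr gauss borel dep) {x. r * norm x < \<bar>x \<bullet> y\<bar>} = emeasure (distr gauss borel dep) {x. r * norm x < \<bar>x \<bullet> z\<bar>}"
      unfolding K_def[symmetric] by (simp add: emeasure_distr)
    have "?f -` (centered -` K r z) = centered -` K r y"
      using reflK[OF yz(3,4), of r] by (auto simp: centered_orthogonal_transformation[OF f refl1[OF yz(1,2)]])
    then have "emeasure gauss (centered -` K r y) = emeasure gauss (centered -` K r z)"
      using emeasure_gauss_orthogonal[OF f, of "centered -` K r z"]
        measurable_sets[OF borel_measurable_centered K, of r z] by simp
    then show "emeasure (distr gauss borel centered) {x. r * norm x < \<bar>x \<bullet> y\<bar>} = emeasure (distr gauss borel centered) {x. r * norm x < \<bar>x \<bullet> z\<bar>}"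
      unfolding K_def[symmetric] by (simp add: emeasure_distr)
  next
    fix r :: real and y assume y: "y \<in> V" "norm y = 1" "r < 1"
    \<comment> \<open>The preimage of the cap is open and contains its centre \<open>y\<close>,
      which \<open>centered\<close> fixes, so the Gaussian measure charges it.\<close>
    have "open (centered -` K r y)"
      using continuous_open_preimage[OF continuous_centered[of UNIV], of "K r y"] \<open>open (K r y)\<close> by simp
    moreover have "y \<in> centered -` K r y"
      using y by (simp add: V_def centered_fixed K_def dot_square_norm)
    ultimately show "emeasure (distr gauss borel centered) {x. r * norm x < \<bar>x \<bullet> y\<bar>} \<noteq> 0"
      using gauss_open_pos[of "centered -` K r y"]
      unfolding K_def[symmetric] by (auto simp: emeasure_distr)
  qed (use U in auto)
  then show ?thesis
    using U(1) by (simp add: emeasure_distr vimage_def)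
qed

text \<open>The vectors without zero entries form an open set stable under nonzero factors, so this
  almost sure property carries over from \<open>centered g\<close>.\<close>

lemma gauss_dep_components_nonzero:
  "AE W :: real ^ 'd ^ ('d::finite option option) in gauss. \<forall>i. dep W $ i \<noteq> 0"
proof -
  interpret G1: prob_space "gauss :: (real ^ 'd ^ ('d option option)) measure" by (rule prob_space_gauss)
  interpret G2: prob_space "gauss :: (real ^ ('d option option)) measure" by (rule prob_space_gauss)
  define U where "U = {x :: real ^ ('d option option). \<forall>i. x $ i \<noteq> 0}"
  have "U = (\<Inter>i. {x. x $ i \<noteq> 0})" by (auto simp: U_def)
  moreover have "open {x :: real ^ ('d option option). x $ i \<noteq> 0}" for i
    by (intro open_Collect_neq continuous_intros)
  ultimately have oU: "open U" by (simp add: open_INT)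
  then have [measurable]: "U \<in> sets borel" by simp
  have "emeasure gauss {W. dep W \<in> U} = emeasure gauss {g. centered g \<in> U}"
    by (rule emeasure_dep_eq_centered[OF oU]) (auto simp: U_def)
  also have "\<dots> = 1"
    using gauss_centered_nonzero(1)[where ?'m="'d option option"]
    by (intro G2.emeasure_eq_1_AE) (auto simp: U_def)
  finally have "AE W in gauss. dep W \<in> U"
    using G1.AE_iff_emeasure_eq_1[of "\<lambda>W. dep W \<in> U"] measurable_sets[OF borel_measurable_dep, of U]
    by (simp add: vimage_def)
  then show ?thesis by (simp add: U_def)
qed

section \<open>General position and Radon partitions\<close>

text \<open>Subtract the multiple of \<open>dep W\<close> that agrees with \<open>l\<close> at
  \<open>None\<close>: the difference is a dependence with a zero entry there, and such a dependence
  vanishes.\<close>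

lemma dependence_unique:
  assumes nz: "\<forall>i. dep W $ i \<noteq> 0"
    and l: "(\<Sum>i\<in>UNIV. l i) = 0" "(\<Sum>i\<in>UNIV. l i *\<^sub>R W $ i) = 0"
  obtains c where "\<And>i. l i = c * dep W $ i"
proof -
  let ?l = "\<chi> i. l i"
  define c where "c = l None / dep W $ None"
  define x where "x = ?l - c *\<^sub>R dep W"
  have "x = 0"
  proof (rule dep_matrix_mult_0D[of W None])
    show "dep W $ None \<noteq> 0" "x $ None = 0" using nz by (auto simp: x_def c_def)
    show "x \<bullet> 1 = 0" using l(1) by (simp add: x_def inner_diff_left dep_inner_one) (simp add: inner_vec_def)
    fix j
    have "?l \<bullet> column j W = (\<Sum>i\<in>UNIV. l i *\<^sub>R W $ i) $ j"
      by (simp add: inner_vec_def column_def)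
    then show "x \<bullet> column j W = 0" using l(2) by (simp add: x_def inner_diff_left dep_inner_column)
  qed
  then have "?l $ i = (c *\<^sub>R dep W) $ i" for i by (simp add: x_def)
  then show ?thesis by (intro that[of c]) simp
qed

text \<open>Two equal points would give a dependence supported on two indices, but every nonzero
  dependence is a multiple of \<open>dep W\<close> and has full support on at least three
  indices.\<close>

lemma dep_nonzero_inj:
  fixes W :: "real ^ 'd::finite ^ ('d option option)"
  assumes nz: "\<forall>i. dep W $ i \<noteq> 0"
  shows "inj (\<lambda>i. W $ i)"
proof (rule injI)
  fix a b assume ab: "W $ a = W $ b"
  show "a = b"
  proof (rule ccontr)
    assume "a \<noteq> b"
    let ?l = "\<lambda>i. if i = a then 1 else if i = b then -1 else (0::real)"
    have split: "(\<Sum>i\<in>UNIV. if i = a then u else if i = b then v else 0) = u + v" for u v :: "'x::ab_group_add"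
      using \<open>a \<noteq> b\<close> by (subst sum.remove[of _ a]) (auto simp: sum.delta cong: if_cong)
    have "(\<Sum>i\<in>UNIV. ?l i) = 0" by (subst split) simp
    moreover have "(\<Sum>i\<in>UNIV. ?l i *\<^sub>R W $ i) = (\<Sum>i\<in>UNIV. if i = a then W $ a else if i = b then - W $ b else 0)"
      by (intro sum.cong) auto
    then have "(\<Sum>i\<in>UNIV. ?l i *\<^sub>R W $ i) = 0" by (subst (asm) split) (simp add: ab)
    ultimately obtain c where c: "\<And>i. ?l i = c * dep W $ i"
      using dependence_unique[OF nz] by blast
    have "\<exists>k. k \<notin> {a, b}"
    proof (rule ccontr)
      assume "\<nexists>k. k \<notin> {a, b}"
      then have "(UNIV :: 'd option option set) = {a, b}" by auto
      moreover have "card {a, b} \<le> 2" by (rule card_2_iff[THEN iffD2, THEN eq_refl]) (use \<open>a \<noteq> b\<close> in blast)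
      moreover have "CARD('d option option) \<ge> 3"
        using zero_less_card_finite[where 'a='d] by simp
      ultimately show False by simp
    qed
    then obtain k where "k \<noteq> a" "k \<noteq> b" by auto
    then have "c = 0" using c[of k] nz by simp
    then show False using c[of a] by simp
  qed
qed

lemma dep_nonzero_general_position:
  fixes W :: "real ^ 'd::finite ^ ('d option option)"
  assumes nz: "\<forall>i. dep W $ i \<noteq> 0"
  shows "general_position (range (\<lambda>i. W $ i))"
  unfolding general_position_def
proof (intro allI impI notI)
  fix T assume T: "T \<subseteq> range (\<lambda>i. W $ i)" "finite T \<and> card T \<le> DIM(real ^ 'd) + 1" and dept: "affine_dependent T"
  have inj: "inj (\<lambda>i. W $ i)" using dep_nonzero_inj[OF nz] .
  obtain U v where U: "sum U T = 0" "v \<in> T" "U v \<noteq> 0" "(\<Sum>v\<in>T. U v *\<^sub>R v) = 0"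
    using affine_dependent_explicit_finite[of T] T(2) dept by auto
  let ?l = "\<lambda>i. if W $ i \<in> T then U (W $ i) else 0"
  have sumT: "(\<Sum>i\<in>UNIV. if W $ i \<in> T then F (W $ i) else 0) = (\<Sum>v\<in>T. F v)" for F :: "_ \<Rightarrow> 'x::comm_monoid_add"
  proof -
    have "(\<Sum>v\<in>T. F v) = (\<Sum>v\<in>range (\<lambda>i. W $ i). if v \<in> T then F v else 0)"
      using T by (subst sum.inter_restrict[symmetric]) (auto simp: Int_absorb1)
    also have "\<dots> = (\<Sum>i\<in>UNIV. if W $ i \<in> T then F (W $ i) else 0)"
      using inj by (subst sum.reindex) auto
    finally show ?thesis by simp
  qed
  have "(\<Sum>i\<in>UNIV. ?l i) = 0" using U(1) sumT[of U] by simp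
  moreover have "(\<Sum>i\<in>UNIV. ?l i *\<^sub>R W $ i) = (\<Sum>i\<in>UNIV. if W $ i \<in> T then U (W $ i) *\<^sub>R W $ i else 0)"
    by (intro sum.cong) auto
  then have "(\<Sum>i\<in>UNIV. ?l i *\<^sub>R W $ i) = 0" using U(4) sumT[of "\<lambda>v. U v *\<^sub>R v"] by simp
  ultimately obtain c where c: "\<And>i. ?l i = c * dep W $ i"
    using dependence_unique[OF nz] by blast
  \<comment> \<open>One point more than \<open>T\<close> may contain: the dependence of
    \<open>T\<close> has a zero entry, while those of all points have none unless they
    vanish.\<close>
  have "card (range (\<lambda>i. W $ i)) = CARD('d) + 2"
    using inj by (subst card_image) auto
  then have "T \<noteq> range (\<lambda>i. W $ i)" using T(2) by auto
  then obtain k where "W $ k \<notin> T" using T(1) by auto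
  then have "c = 0" using c[of k] nz by auto
  moreover obtain i where "v = W $ i" using U(2) T(1) by auto
  ultimately show False using c[of i] U by simp
qed

text \<open>Subtracting the two convex combinations of a common point gives a dependence that is
  nonnegative on \<open>A\<close> and nonpositive on \<open>B\<close>. It is a nonzero multiple of
  \<open>dep W\<close>, hence without zeros, and its signs recover the parts; the sign of the factor
  decides which is which.\<close>

lemma radon_partition_dep:
  fixes W :: "real ^ 'd::finite ^ ('d option option)"
  assumes nz: "\<forall>i. dep W $ i \<noteq> 0"
    and disj: "A \<inter> B = {}" and un: "A \<union> B = range (\<lambda>i. W $ i)"
    and hull: "convex hull A \<inter> convex hull B \<noteq> {}"
  shows "(A = (\<lambda>i. W $ i) ` {i. dep W $ i > 0} \<and> B = (\<lambda>i. W $ i) ` {i. dep W $ i < 0})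
       \<or> (A = (\<lambda>i. W $ i) ` {i. dep W $ i < 0} \<and> B = (\<lambda>i. W $ i) ` {i. dep W $ i > 0})"
proof -
  have inj: "inj (\<lambda>i. W $ i)" using dep_nonzero_inj[OF nz] .
  have fin: "finite A" "finite B" by (metis un finite_Un finite_imageI finite)+
  obtain z where "z \<in> convex hull A" "z \<in> convex hull B" using hull by auto
  then obtain u v where u: "\<And>x. x \<in> A \<Longrightarrow> 0 \<le> u x" "sum u A = 1" "(\<Sum>x\<in>A. u x *\<^sub>R x) = z"
    and v: "\<And>x. x \<in> B \<Longrightarrow> 0 \<le> v x" "sum v B = 1" "(\<Sum>x\<in>B. v x *\<^sub>R x) = z"
    using fin by (auto simp: convex_hull_finite)
  define F where "F x = (if x \<in> A then u x else - v x)" for x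
  have split: "(\<Sum>i\<in>UNIV. G (W $ i)) = sum G A + sum G B" for G :: "_ \<Rightarrow> 'x::comm_monoid_add"
  proof -
    have "(\<Sum>i\<in>UNIV. G (W $ i)) = sum G (range (\<lambda>i. W $ i))"
      using inj by (subst sum.reindex) auto
    also have "\<dots> = sum G A + sum G B"
      unfolding un[symmetric] by (rule sum.union_disjoint[OF fin disj])
    finally show ?thesis .
  qed
  have FA: "sum F A = 1" "(\<Sum>x\<in>A. F x *\<^sub>R x) = z"
    using u by (auto simp: F_def)
  have FB: "sum F B = -1" "(\<Sum>x\<in>B. F x *\<^sub>R x) = -z"
  proof -
    have "x \<in> B \<Longrightarrow> F x = - v x" for x using disj by (auto simp: F_def)
    then show "sum F B = -1" "(\<Sum>x\<in>B. F x *\<^sub>R x) = -z"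
      using v by (simp_all add: sum_negf)
  qed
  have "(\<Sum>i\<in>UNIV. F (W $ i)) = 0" using split[of F] FA FB by simp
  moreover have "(\<Sum>i\<in>UNIV. F (W $ i) *\<^sub>R W $ i) = 0" using split[of "\<lambda>x. F x *\<^sub>R x"] FA FB by simp
  ultimately obtain c where c: "\<And>i. F (W $ i) = c * dep W $ i"
    using dependence_unique[OF nz] by blast
  have "c \<noteq> 0"
  proof
    assume "c = 0"
    have "F x = 0" if x: "x \<in> A" for x
    proof -
      obtain i where "x = W $ i" using x un by blast
      then show ?thesis using c[of i] \<open>c = 0\<close> by simp
    qed
    then have "sum F A = 0" by simp
    then show False using FA by simp
  qed
  then have Fnz: "F (W $ i) \<noteq> 0" for i using c nz by simp
  have A: "W $ i \<in> A \<longleftrightarrow> F (W $ i) > 0" for i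
  proof
    assume "W $ i \<in> A"
    then show "F (W $ i) > 0" using u(1)[of "W $ i"] Fnz[of i] by (auto simp: F_def)
  next
    assume *: "F (W $ i) > 0"
    show "W $ i \<in> A"
    proof (rule ccontr)
      assume "W $ i \<notin> A"
      then show False using * v(1)[of "W $ i"] un by (auto simp: F_def)
    qed
  qed
  have B: "W $ i \<in> B \<longleftrightarrow> F (W $ i) < 0" for i
  proof -
    have "W $ i \<in> A \<union> B" unfolding un by simp
    then have "W $ i \<in> B \<longleftrightarrow> W $ i \<notin> A" using disj by auto
    then show ?thesis using A[of i] Fnz[of i] by auto
  qed
  have sub: "A \<subseteq> range (\<lambda>i. W $ i)" "B \<subseteq> range (\<lambda>i. W $ i)" using un by auto
  have imA: "A = (\<lambda>i. W $ i) ` {i. F (W $ i) > 0}" using A sub(1) by blast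
  have imB: "B = (\<lambda>i. W $ i) ` {i. F (W $ i) < 0}" using B sub(2) by blast
  show ?thesis
  proof (cases "c > 0")
    case True
    then show ?thesis using imA imB by (simp add: c zero_less_mult_iff mult_less_0_iff)
  next
    case False
    then have "c < 0" using \<open>c \<noteq> 0\<close> by simp
    then show ?thesis using imA imB by (simp add: c zero_less_mult_iff mult_less_0_iff)
  qed
qed

text \<open>Radon's theorem provides some partition, and the preceding lemma forces every partition
  to be the pair on the right, which is therefore one itself.\<close>

lemma radon_partition_dep_iff:
  fixes W :: "real ^ 'd::finite ^ ('d option option)"
  assumes nz: "\<forall>i. dep W $ i \<noteq> 0"
  shows "radon_partition (range (\<lambda>i. W $ i)) Q \<longleftrightarrow>
     Q = {(\<lambda>i. W $ i) ` {i. dep W $ i > 0}, (\<lambda>i. W $ i) ` {i. dep W $ i < 0}}" (is "?L Q \<longleftrightarrow> Q = ?Q")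
proof -
  have 1: "Q = ?Q" if "?L Q" for Q
  proof -
    have "\<exists>A B. Q = {A, B} \<and> A \<union> B = range (\<lambda>i. W $ i) \<and> A \<inter> B = {} \<and> convex hull A \<inter> convex hull B \<noteq> {}"
      using that unfolding radon_partition_def .
    then obtain A B where AB: "Q = {A, B}" "A \<union> B = range (\<lambda>i. W $ i)" "A \<inter> B = {}" "convex hull A \<inter> convex hull B \<noteq> {}"
      by (elim exE conjE)
    show ?thesis
      using radon_partition_dep[OF nz AB(3,2,4)] unfolding AB(1) by (elim disjE conjE) (simp_all add: insert_commute)
  qed
  have "card (range (\<lambda>i. W $ i)) = CARD('d) + 2"
    using dep_nonzero_inj[OF nz] by (subst card_image) auto
  then have "affine_dependent (range (\<lambda>i. W $ i))"
    by (intro affine_dependent_biggerset) auto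
  then obtain M P where "M \<inter> P = {}" "M \<union> P = range (\<lambda>i. W $ i)" "convex hull M \<inter> convex hull P \<noteq> {}"
    using Radon_partition[of "range (\<lambda>i. W $ i)"] by auto
  then have "?L {M, P}" unfolding radon_partition_def by blast
  then show ?thesis using 1 by metis
qed

section \<open>Ultra log-concavity\<close>

text \<open>The quantity \<open>q k\<close> of the overview with \<open>k = card J\<close>, for an
  arbitrary set \<open>J\<close> of positions of the positive entries.\<close>

definition sign_prob :: "'m::finite set \<Rightarrow> real" where
  "sign_prob J = measure gauss {g. centered g \<in> sign_cone (\<lambda>i. i \<in> J)}"

lemma open_sign_cone: "open (sign_cone \<sigma>)"
proof -
  have "sign_cone \<sigma> = (\<Inter>i. {x. if \<sigma> i then x $ i > 0 else x $ i < 0})"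
    by (auto simp: sign_cone_def)
  moreover have "open {x. if \<sigma> i then x $ i > 0 else x $ i < (0::real)}" for i
    by (cases "\<sigma> i") (auto intro!: open_Collect_less continuous_intros)
  ultimately show ?thesis by (simp add: open_INT)
qed

lemma sets_sign_cone[measurable]: "sign_cone \<sigma> \<in> sets borel"
  by (rule borel_open[OF open_sign_cone])

lemma sets_centered_sign_cone: "centered -` sign_cone \<sigma> \<in> sets borel"
  using measurable_sets[OF borel_measurable_centered sets_sign_cone[of \<sigma>]] by simp

text \<open>A permutation of the coordinates is an isometry that fixes \<open>1\<close>; one that
  maps \<open>J\<close> onto \<open>J'\<close> is glued from bijections of the sets and of their
  complements.\<close>

lemma sign_prob_card:
  fixes J J' :: "'m::finite set"
  assumes "card J = card J'"
  shows "sign_prob J = sign_prob J'"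
proof -
  obtain h where h: "bij_betw h J J'" using assms by (meson finite finite_same_card_bij)
  have "card (- J) = card (- J')" using assms by (simp add: Compl_eq_Diff_UNIV card_Diff_subset)
  then obtain h' where h': "bij_betw h' (- J) (- J')" by (meson finite finite_same_card_bij)
  define p where "p i = (if i \<in> J then h i else h' i)" for i
  have "bij_betw p (J \<union> - J) (J' \<union> - J')"
  proof (rule bij_betw_combine)
    show "bij_betw p J J'" using h by (subst bij_betw_cong[of J p h]) (auto simp: p_def)
    show "bij_betw p (-J) (-J')" using h' by (subst bij_betw_cong[of "-J" p h']) (auto simp: p_def)
  qed auto
  then have p: "bij p" by simp
  have pJ: "p i \<in> J' \<longleftrightarrow> i \<in> J" for i
    using bij_betwE[OF h] bij_betwE[OF h'] by (auto simp: p_def)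
  let ?f = "\<lambda>x :: real ^ 'm. \<chi> i. x $ p i"
  have f: "orthogonal_transformation ?f"
    unfolding orthogonal_transformation_def
  proof (intro conjI allI)
    show "linear ?f" by (rule linearI) (auto simp: vec_eq_iff)
    fix x y :: "real ^ 'm"
    show "?f x \<bullet> ?f y = x \<bullet> y"
      unfolding inner_vec_def using sum.reindex_bij_betw[OF p, of "\<lambda>i. x $ i \<bullet> y $ i"] by simp
  qed
  have "?f 1 = 1" by (simp add: vec_eq_iff)
  have "?f x \<in> sign_cone (\<lambda>i. i \<in> J) \<longleftrightarrow> x \<in> sign_cone (\<lambda>i. i \<in> J')" for x
  proof -
    have "?f x \<in> sign_cone (\<lambda>i. i \<in> J) \<longleftrightarrow> (\<forall>i. if p i \<in> J' then x $ p i > 0 else x $ p i < 0)"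
      by (simp add: sign_cone_def pJ)
    also have "\<dots> \<longleftrightarrow> (\<forall>k. if k \<in> J' then x $ k > 0 else x $ k < 0)"
      using p by (metis bij_pointE)
    finally show ?thesis by (simp add: sign_cone_def)
  qed
  then have "?f -` (centered -` sign_cone (\<lambda>i. i \<in> J)) = centered -` sign_cone (\<lambda>i. i \<in> J')"
    by (auto simp: centered_orthogonal_transformation[OF f \<open>?f 1 = 1\<close>])
  then have "emeasure gauss (centered -` sign_cone (\<lambda>i. i \<in> J)) = emeasure gauss (centered -` sign_cone (\<lambda>i. i \<in> J'))"
    using emeasure_gauss_orthogonal[OF f sets_centered_sign_cone[of "\<lambda>i. i \<in> J"]] by simp
  then show ?thesis by (simp add: sign_prob_def measure_def vimage_def)
qed

lemma sign_prob_uminus: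
  "measure gauss {g. - centered g \<in> sign_cone (\<lambda>i. i \<in> J)} = sign_prob J"
proof -
  have f: "orthogonal_transformation (uminus :: real ^ 'a \<Rightarrow> real ^ 'a)"
    by (auto simp: orthogonal_transformation_def intro!: linearI)
  have "centered (- g) = - centered g" for g :: "real ^ 'a" by (simp add: centered_eq)
  then have "uminus -` (centered -` sign_cone (\<lambda>i. i \<in> J)) = {g. - centered g \<in> sign_cone (\<lambda>i. i \<in> J)}"
    by (auto simp: vimage_def)
  then show ?thesis
    using emeasure_gauss_orthogonal[OF f sets_centered_sign_cone[of "\<lambda>i. i \<in> J"]]
    by (simp add: sign_prob_def measure_def vimage_def)
qed

text \<open>Add two further indices \<open>a\<close>, \<open>b\<close> to \<open>J0\<close>, singly
  and together. Since only cardinalities matter, these sets stand for \<open>J1\<close>,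
  \<open>J1\<close> and \<open>J2\<close>.\<close>

lemma sign_prob_log_concave:
  fixes J0 J1 J2 :: "'m::finite set"
  assumes m: "CARD('m) \<ge> 3" and k: "card J1 = Suc (card J0)" "card J2 = Suc (card J1)"
  shows "sign_prob J2 * sign_prob J0 \<le> (sign_prob J1)\<^sup>2"
proof -
  interpret prob_space "gauss :: (real ^ 'm) measure" by (rule prob_space_gauss)
  have "card J2 \<le> CARD('m)" by (rule card_mono) auto
  then have "2 \<le> card (- J0)" using k by (simp add: Compl_eq_Diff_UNIV card_Diff_subset)
  then obtain T where "T \<subseteq> - J0" "card T = 2" by (metis obtain_subset_with_card_n)
  then obtain a b where ab: "a \<noteq> b" "a \<notin> J0" "b \<notin> J0" by (auto simp: card_2_iff)
  have q: "emeasure gauss {g. centered g \<in> sign_cone \<sigma>} = ennreal (sign_prob {i. \<sigma> i})" for \<sigma> :: "'m \<Rightarrow> bool"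
    by (simp add: sign_prob_def emeasure_eq_measure)
  have s: "{i. ((\<lambda>i. i \<in> J0)(a := True, b := True)) i} = insert a (insert b J0)"
    "{i. ((\<lambda>i. i \<in> J0)(a := False, b := False)) i} = J0"
    "{i. ((\<lambda>i. i \<in> J0)(a := True, b := False)) i} = insert a J0"
    "{i. ((\<lambda>i. i \<in> J0)(a := False, b := True)) i} = insert b J0"
    using ab by auto
  have "ennreal (sign_prob (insert a (insert b J0))) * ennreal (sign_prob J0)
     \<le> ennreal (sign_prob (insert a J0)) * ennreal (sign_prob (insert b J0))"
    using emeasure_centered_sign_cone_exchange[OF ab(1) m, of "\<lambda>i. i \<in> J0"] unfolding q s .
  moreover have nn: "sign_prob K \<ge> 0" for K :: "'m set" by (simp add: sign_prob_def)
  ultimately have "sign_prob (insert a (insert b J0)) * sign_prob J0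
     \<le> sign_prob (insert a J0) * sign_prob (insert b J0)"
    by (simp flip: ennreal_mult add: ennreal_le_iff)
  moreover have "sign_prob (insert a (insert b J0)) = sign_prob J2"
    "sign_prob (insert a J0) = sign_prob J1" "sign_prob (insert b J0) = sign_prob J1"
    using ab k by (auto intro!: sign_prob_card)
  ultimately show ?thesis by (simp add: power2_eq_square)
qed

text \<open>The factor \<open>s\<close> will be \<open>1\<close> or \<open>-1\<close>, so that
  positive and negative entries are treated at once.\<close>

lemma sets_dep_count:
  "{W :: real ^ 'd ^ ('d::finite option option). card {i. s * dep W $ i > 0} = k} \<in> sets borel"
proof -
  let ?K = "{J :: 'd option option set. card J = k}"
  have "Measurable.pred borel (\<lambda>W. s * dep W $ i > 0)" for i
  proof -
    have "(\<lambda>W. dep W $ i) \<in> borel_measurable borel"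
      using measurable_compose[OF borel_measurable_dep measurable_vec_nth'[of i]] .
    then show ?thesis by measurable
  qed
  note [measurable] = this
  have "{W \<in> space borel. \<exists>J\<in>?K. \<forall>i. i \<in> J \<longleftrightarrow> s * dep W $ i > 0} \<in> sets borel"
    by measurable
  moreover have "{W \<in> space borel. \<exists>J\<in>?K. \<forall>i. i \<in> J \<longleftrightarrow> s * dep W $ i > 0} = {W. card {i. s * dep W $ i > 0} = k}"
  proof -
    have "(\<exists>J\<in>?K. \<forall>i. i \<in> J \<longleftrightarrow> s * dep W $ i > 0) \<longleftrightarrow> card {i. s * dep W $ i > 0} = k" for W
    proof -
      have "(\<forall>i. i \<in> J \<longleftrightarrow> s * dep W $ i > 0) \<longleftrightarrow> J = {i. s * dep W $ i > 0}" for J by auto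
      then show ?thesis by auto
    qed
    then show ?thesis by simp
  qed
  ultimately show ?thesis by (simp only:)
qed

text \<open>Split by the set \<open>J\<close> of positions counted. A single cone is not stable
  under negative factors, but its union \<open>U J\<close> with the opposite cone is; this is why
  only the sum of the two counts is evaluated. Both halves of \<open>U J\<close> have probability
  \<open>sign_prob J\<close> for the centered Gaussian vector.\<close>

lemma dep_sign_count:
  fixes k :: nat
  defines "M \<equiv> (gauss :: (real ^ 'd ^ ('d::finite option option)) measure)"
  assumes J0: "card (J0 :: 'd option option set) = k"
  shows "measure M {W. card {i. dep W $ i > 0} = k} + measure M {W. card {i. dep W $ i < 0} = k}
     = 2 * real (CARD('d option option) choose k) * sign_prob J0"
proof -
  interpret M: prob_space M unfolding M_def by (rule prob_space_gauss)
  interpret G: prob_space "gauss :: (real ^ ('d option option)) measure" by (rule prob_space_gauss)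
  have [measurable_cong, simp]: "sets M = sets borel" and [simp]: "space M = UNIV" by (simp_all add: M_def)
  have nz: "AE W in M. \<forall>i. dep W $ i \<noteq> 0" unfolding M_def by (rule gauss_dep_components_nonzero)
  let ?K = "{J :: 'd option option set. card J = k}"
  let ?C = "\<lambda>J. sign_cone (\<lambda>i. i \<in> J)"
  define U where "U J = ?C J \<union> uminus -` ?C J" for J :: "'d option option set"
  have C'o: "open (uminus -` ?C J)" for J :: "'d option option set"
    by (intro open_vimage open_sign_cone continuous_intros)
  have Uo: "open (U J)" for J unfolding U_def using C'o open_sign_cone by auto
  have Uc: "c *\<^sub>R x \<in> U J" if "x \<in> U J" "c \<noteq> 0" for c x J
  proof -
    have sc: "a *\<^sub>R y \<in> ?C J \<longleftrightarrow> y \<in> ?C J" if "a > 0" for a y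
      using that by (simp add: sign_cone_def zero_less_mult_iff mult_less_0_iff)
    show ?thesis
      using that sc[of c x] sc[of c "-x"] sc[of "-c" x] sc[of "-c" "-x"]
      by (cases "c > 0") (auto simp: U_def)
  qed
  have disj: "?C J \<inter> uminus -` ?C J = {}" for J :: "'d option option set"
    by (force simp: sign_cone_def)
  have [measurable]: "uminus -` ?C J \<in> sets borel" for J :: "'d option option set" using C'o by simp
  have dC: "{W. dep W \<in> B} \<in> sets borel" if "B \<in> sets borel" for B :: "(real ^ ('d option option)) set"
    using measurable_sets[OF borel_measurable_dep that] by (simp add: vimage_def)
  have cC: "{g. centered g \<in> B} \<in> sets borel" if "B \<in> sets borel" for B :: "(real ^ ('d option option)) set"
    using measurable_sets[OF borel_measurable_centered that] by (simp add: vimage_def)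
  have one: "measure M {W. dep W \<in> ?C J} + measure M {W. - dep W \<in> ?C J} = 2 * sign_prob J" for J
  proof -
    have "measure M {W. dep W \<in> ?C J} + measure M {W. - dep W \<in> ?C J} = measure M {W. dep W \<in> U J}"
      using disj[of J] dC[of "?C J"] dC[of "uminus -` ?C J"]
      by (subst M.finite_measure_Union[symmetric]) (auto simp: U_def intro!: arg_cong[where f="measure M"])
    also have "\<dots> = measure gauss {g. centered g \<in> U J}"
      using emeasure_dep_eq_centered[OF Uo Uc, of J] by (simp add: measure_def M_def)
    also have "\<dots> = measure gauss {g. centered g \<in> ?C J} + measure gauss {g. - centered g \<in> ?C J}"
      using disj[of J] cC[of "?C J"] cC[of "uminus -` ?C J"]
      by (subst G.finite_measure_Union[symmetric]) (auto simp: U_def intro!: arg_cong[where f="measure gauss"])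
    finally show ?thesis by (simp add: sign_prob_uminus) (simp add: sign_prob_def)
  qed
  have pos: "measure M {W. card {i. s * dep W $ i > 0} = k} = (\<Sum>J\<in>?K. measure M {W. s *\<^sub>R dep W \<in> ?C J})" if "s \<noteq> 0" for s
  proof -
    have mb: "{W. s *\<^sub>R dep W \<in> ?C J} \<in> sets borel" for J
    proof -
      have "{W \<in> space borel. s *\<^sub>R dep W \<in> ?C J} \<in> sets borel" by measurable
      then show ?thesis by simp
    qed
    have "measure M {W. card {i. s * dep W $ i > 0} = k} = measure M (\<Union>J\<in>?K. {W. s *\<^sub>R dep W \<in> ?C J})"
    proof (rule M.finite_measure_eq_AE)
      show "AE W in M. (W \<in> {W. card {i. s * dep W $ i > 0} = k}) = (W \<in> (\<Union>J\<in>?K. {W. s *\<^sub>R dep W \<in> ?C J}))"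
        using nz
      proof eventually_elim
        case (elim W)
        have "(s *\<^sub>R dep W \<in> ?C J) \<longleftrightarrow> J = {i. s * dep W $ i > 0}" for J
        proof
          assume "s *\<^sub>R dep W \<in> ?C J"
          then have H: "\<forall>i. if i \<in> J then (s *\<^sub>R dep W) $ i > 0 else (s *\<^sub>R dep W) $ i < 0" by (simp add: sign_cone_def)
          have *: "if i \<in> J then s * dep W $ i > 0 else s * dep W $ i < 0" for i
            using spec[OF H, of i] by (cases "i \<in> J") simp_all
          show "J = {i. s * dep W $ i > 0}"
          proof (intro set_eqI)
            fix i show "(i \<in> J) = (i \<in> {i. s * dep W $ i > 0})"
              using *[of i] by (cases "i \<in> J") auto
          qed
        next
          assume "J = {i. s * dep W $ i > 0}"
          moreover have "s * dep W $ i \<noteq> 0" for i using elim that by simp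
          ultimately show "s *\<^sub>R dep W \<in> ?C J" by (auto simp: sign_cone_def not_less less_le)
        qed
        then show ?case by auto
      qed
      show "(\<Union>J\<in>?K. {W. s *\<^sub>R dep W \<in> ?C J}) \<in> M.events" using mb by auto
      show "{W. card {i. s * dep W $ i > 0} = k} \<in> M.events"
        using sets_dep_count by simp
    qed
    also have "\<dots> = (\<Sum>J\<in>?K. measure M {W. s *\<^sub>R dep W \<in> ?C J})"
    proof (rule M.finite_measure_finite_Union)
      show "disjoint_family_on (\<lambda>J. {W. s *\<^sub>R dep W \<in> ?C J}) ?K"
        unfolding disjoint_family_on_def
      proof (intro ballI impI)
        fix J J' :: "'d option option set" assume "J \<noteq> J'"
        then obtain i where "(i \<in> J) \<noteq> (i \<in> J')" by auto
        then show "{W. s *\<^sub>R dep W \<in> ?C J} \<inter> {W. s *\<^sub>R dep W \<in> ?C J'} = {}"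
          by (auto simp: sign_cone_def) (metis less_asym)+
      qed
    qed (use mb in auto)
    finally show ?thesis .
  qed
  have "measure M {W. card {i. dep W $ i > 0} = k} + measure M {W. card {i. dep W $ i < 0} = k}
    = (\<Sum>J\<in>?K. measure M {W. dep W \<in> ?C J} + measure M {W. - dep W \<in> ?C J})"
    using pos[of 1] pos[of "-1"] by (simp add: sum.distrib)
  also have "\<dots> = (\<Sum>J\<in>?K. 2 * sign_prob J0)"
    unfolding one using J0 by (intro sum.cong refl) (auto intro: sign_prob_card)
  also have "\<dots> = card ?K * (2 * sign_prob J0)" by simp
  also have "card ?K = CARD('d option option) choose k"
    using n_subsets[of "UNIV :: 'd option option set" k] by simp
  finally show ?thesis by simp
qed

section \<open>Passage to the sample space and the random part\<close>

text \<open>The enumeration \<open>e\<close> turns the numbered family of points into a matrix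
  indexed by a finite type, where the results on \<open>gauss\<close> apply.\<close>

lemma distr_points_gauss:
  fixes M :: "'w measure" and X :: "nat \<Rightarrow> 'w \<Rightarrow> real ^ 'd" and e :: "'m::finite \<Rightarrow> nat"
  assumes M: "prob_space M" and indep: "prob_space.indep_vars M (\<lambda>_. borel) X {..<n}"
    and d: "\<And>i. i < n \<Longrightarrow> distributed M lborel (X i) (\<lambda>x. ennreal (std_normal_vec_density x))"
    and e: "bij_betw e UNIV {..<n}"
  shows "distr M borel (\<lambda>\<omega>. \<chi> i. X (e i) \<omega>) = gauss"
    and "(\<lambda>\<omega>. \<chi> i. X (e i) \<omega>) \<in> borel_measurable M"
proof -
  interpret prob_space M by fact
  have rv: "X i \<in> borel_measurable M" if "i < n" for i
    using distributed_measurable[OF d[OF that]] by simp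
  have law: "distr M borel (X i) = gauss" if "i < n" for i
  proof -
    have "distr M borel (X i) = distr M lborel (X i)" by (rule distr_cong) auto
    also have "\<dots> = density lborel (\<lambda>x. ennreal (std_normal_vec_density x))"
      using distributed_distr_eq_density[OF d[OF that]] .
    also have "\<dots> = gauss" by (simp add: gauss_def std_normal_vec_density_eq)
    finally show ?thesis .
  qed
  have eI: "e i < n" for i using bij_betwE[OF e] by auto
  have "{..<n} \<noteq> {}" using eI by auto
  then have "distr M (\<Pi>\<^sub>M i\<in>{..<n}. borel) (\<lambda>x. \<lambda>i\<in>{..<n}. X i x) = (\<Pi>\<^sub>M i\<in>{..<n}. distr M borel (X i))"
    using indep rv by (subst (asm) indep_vars_iff_distr_eq_PiM') auto
  also have "\<dots> = (\<Pi>\<^sub>M i\<in>{..<n}. gauss)"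
    by (intro PiM_cong refl law) simp
  finally have joint: "distr M (\<Pi>\<^sub>M i\<in>{..<n}. borel) (\<lambda>x. \<lambda>i\<in>{..<n}. X i x) = (\<Pi>\<^sub>M i\<in>{..<n}. gauss)" .
  have sets_eq: "sets (\<Pi>\<^sub>M i\<in>J. (gauss :: (real ^ 'd) measure)) = sets (\<Pi>\<^sub>M i\<in>J. borel)" for J :: "'x set"
    by (rule sets_PiM_cong) auto
  have mX: "(\<lambda>x. \<lambda>i\<in>{..<n}. X i x) \<in> M \<rightarrow>\<^sub>M (\<Pi>\<^sub>M i\<in>{..<n}. borel)"
    by (rule measurable_restrict) (simp add: rv)
  have mE: "(\<lambda>\<omega>. \<lambda>i\<in>UNIV. \<omega> (e i)) \<in> (\<Pi>\<^sub>M i\<in>{..<n}. (borel :: (real ^ 'd) measure)) \<rightarrow>\<^sub>M (\<Pi>\<^sub>M i\<in>UNIV. borel)"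
    by (intro measurable_restrict measurable_component_singleton) (simp add: eI)
  have mL: "(\<lambda>x. \<chi> i. x i) \<in> (\<Pi>\<^sub>M i\<in>(UNIV::'m set). (borel::(real ^ 'd) measure)) \<rightarrow>\<^sub>M borel"
    by (rule measurable_vec_lambda)
  have comp: "(\<lambda>x. \<chi> i. x i) \<circ> (\<lambda>\<omega>. \<lambda>i\<in>UNIV. \<omega> (e i)) \<circ> (\<lambda>x. \<lambda>i\<in>{..<n}. X i x) = (\<lambda>\<omega>. \<chi> i. X (e i) \<omega>)"
    using eI by (auto simp: fun_eq_iff vec_eq_iff)
  show "(\<lambda>\<omega>. \<chi> i. X (e i) \<omega>) \<in> borel_measurable M"
    using measurable_comp[OF mX measurable_comp[OF mE mL]] comp by (simp add: comp_assoc)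
  have "gauss = distr (\<Pi>\<^sub>M i\<in>(UNIV::'m set). gauss) borel (\<lambda>x. (\<chi> i. x i) :: real ^ 'd ^ 'm)"
    by (rule gauss_vec)
  also have "(\<Pi>\<^sub>M i\<in>(UNIV::'m set). (gauss :: (real ^ 'd) measure)) = distr (\<Pi>\<^sub>M i\<in>{..<n}. gauss) (\<Pi>\<^sub>M i\<in>UNIV. gauss) (\<lambda>\<omega>. \<lambda>i\<in>UNIV. \<omega> (e i))"
    using e by (intro distr_PiM_reindex[symmetric] prob_space_gauss) (auto simp: bij_betw_def)
  also have "\<dots> = distr (distr M (\<Pi>\<^sub>M i\<in>{..<n}. borel) (\<lambda>x. \<lambda>i\<in>{..<n}. X i x)) (\<Pi>\<^sub>M i\<in>UNIV. borel) (\<lambda>\<omega>. \<lambda>i\<in>UNIV. \<omega> (e i))"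
    unfolding joint by (rule distr_cong) (auto simp: sets_eq)
  also have "\<dots> = distr M (\<Pi>\<^sub>M i\<in>UNIV. borel) ((\<lambda>\<omega>. \<lambda>i\<in>UNIV. \<omega> (e i)) \<circ> (\<lambda>x. \<lambda>i\<in>{..<n}. X i x))"
    by (rule distr_distr[OF mE mX])
  also have "distr \<dots> borel (\<lambda>x. \<chi> i. x i) = distr M borel ((\<lambda>x. \<chi> i. x i) \<circ> ((\<lambda>\<omega>. \<lambda>i\<in>UNIV. \<omega> (e i)) \<circ> (\<lambda>x. \<lambda>i\<in>{..<n}. X i x)))"
    by (rule distr_distr[OF mL measurable_comp[OF mX mE]])
  finally show "distr M borel (\<lambda>\<omega>. \<chi> i. X (e i) \<omega>) = gauss"
    using comp by (simp add: comp_assoc)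
qed

text \<open>Points may coincide on a null set, so the cardinality of an image is built up one index
  at a time: it grows unless the new point equals an earlier one.\<close>

lemma measurable_card_image:
  fixes X :: "'i \<Rightarrow> 'w \<Rightarrow> 'a::euclidean_space"
  assumes "finite J" "\<And>i. i \<in> J \<Longrightarrow> X i \<in> borel_measurable M"
  shows "(\<lambda>\<omega>. card ((\<lambda>i. X i \<omega>) ` J)) \<in> M \<rightarrow>\<^sub>M count_space UNIV"
  using assms
proof (induction J)
  case (insert j J)
  have [measurable]: "(\<lambda>\<omega>. card ((\<lambda>i. X i \<omega>) ` J)) \<in> M \<rightarrow>\<^sub>M count_space UNIV"
    using insert by auto
  have "Measurable.pred M (\<lambda>\<omega>. X i \<omega> = X j \<omega>)" if "i \<in> J" for i
  proof -
    have [measurable]: "X i \<in> borel_measurable M" "X j \<in> borel_measurable M" using insert.prems that by auto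
    have "Measurable.pred M (\<lambda>\<omega>. X i \<omega> - X j \<omega> = 0)" by measurable
    then show ?thesis by simp
  qed
  then have [measurable]: "Measurable.pred M (\<lambda>\<omega>. \<exists>i\<in>J. X i \<omega> = X j \<omega>)"
    using insert.hyps by (intro pred_intros_finite(4))
  have "(\<lambda>\<omega>. card ((\<lambda>i. X i \<omega>) ` insert j J)) =
     (\<lambda>\<omega>. if \<exists>i\<in>J. X i \<omega> = X j \<omega> then card ((\<lambda>i. X i \<omega>) ` J) else Suc (card ((\<lambda>i. X i \<omega>) ` J)))"
  proof
    fix \<omega>
    have "X j \<omega> \<in> (\<lambda>i. X i \<omega>) ` J \<longleftrightarrow> (\<exists>i\<in>J. X i \<omega> = X j \<omega>)" by (auto simp: image_iff eq_commute)
    then show "card ((\<lambda>i. X i \<omega>) ` insert j J) =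
     (if \<exists>i\<in>J. X i \<omega> = X j \<omega> then card ((\<lambda>i. X i \<omega>) ` J) else Suc (card ((\<lambda>i. X i \<omega>) ` J)))"
      using insert.hyps by (simp add: card_insert_if)
  qed
  then show ?case by simp
qed simp

text \<open>The naming \<open>I\<close> may depend on the points, so the law of
  \<open>card (I \<omega>)\<close> alone is not determined. The independent fair coin averages it
  with the complementary count, and this average depends only on the unordered partition.\<close>

lemma prob_card_uniform_radon_part:
  fixes X :: "nat \<Rightarrow> 'w \<Rightarrow> 'v::euclidean_space" and P :: "'w \<Rightarrow> nat set"
  assumes M: "prob_space M" and S: "uniform_radon_part M n X S"
    and X: "\<And>i. i < n \<Longrightarrow> X i \<in> borel_measurable M"
    and inj: "AE \<omega> in M. inj_on (\<lambda>i. X i \<omega>) {..<n}"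
    and P: "(\<lambda>\<omega>. card (P \<omega>)) \<in> M \<rightarrow>\<^sub>M count_space UNIV" "\<And>\<omega>. P \<omega> \<subseteq> {..<n}"
    and radon: "AE \<omega> in M. \<forall>Q. radon_partition ((\<lambda>i. X i \<omega>) ` {..<n}) Q \<longrightarrow>
      Q = {(\<lambda>i. X i \<omega>) ` P \<omega>, (\<lambda>i. X i \<omega>) ` ({..<n} - P \<omega>)}"
  shows "measure M {\<omega> \<in> space M. card (S \<omega>) = k}
    = (measure M {\<omega> \<in> space M. card (P \<omega>) = k} + measure M {\<omega> \<in> space M. n - card (P \<omega>) = k}) / 2"
proof -
  interpret prob_space M by fact
  obtain I A B C where A: "\<And>\<omega>. A \<omega> = (\<lambda>i. X i \<omega>) ` I \<omega>" and B: "\<And>\<omega>. B \<omega> = (\<lambda>i. X i \<omega>) ` ({..<n} - I \<omega>)"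
    and part: "AE \<omega> in M. radon_partition ((\<lambda>i. X i \<omega>) ` {..<n}) {A \<omega>, B \<omega>}"
    and half: "prob {\<omega> \<in> space M. C \<omega>} = 1 / 2"
    and ind: "indep_rv M (count_space UNIV) C
        (PiM {..<n} (\<lambda>_. borel) \<Otimes>\<^sub>M count_space (Pow {..<n})) (\<lambda>\<omega>. (\<lambda>i\<in>{..<n}. X i \<omega>, I \<omega>))"
    and S: "S = (\<lambda>\<omega>. if C \<omega> then A \<omega> else B \<omega>)"
    using S unfolding uniform_radon_part_def by blast
  let ?N = "PiM {..<n} (\<lambda>_. borel :: 'v measure) \<Otimes>\<^sub>M count_space (Pow {..<n})"
  let ?Z = "\<lambda>\<omega>. (\<lambda>i\<in>{..<n}. X i \<omega>, I \<omega>)"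
  have C[measurable]: "C \<in> M \<rightarrow>\<^sub>M count_space UNIV" and Z: "?Z \<in> M \<rightarrow>\<^sub>M ?N"
    and indep: "indep_set {C -` U \<inter> space M | U. U \<in> sets (count_space UNIV)} {?Z -` V \<inter> space M | V. V \<in> sets ?N}"
    using ind by (auto simp: indep_rv_def)
  have I[measurable]: "I \<in> M \<rightarrow>\<^sub>M count_space (Pow {..<n})"
    using measurable_compose[OF Z measurable_snd] by simp
  have I_sub: "I \<omega> \<subseteq> {..<n}" if "\<omega> \<in> space M" for \<omega>
    using measurable_space[OF I that] by simp
  have card_diff: "card ({..<n} - J) = n - card J" if "J \<subseteq> {..<n}" for J
    using that by (simp add: card_Diff_subset finite_subset)
  have parts: "AE \<omega> in M. inj_on (\<lambda>i. X i \<omega>) {..<n} \<and> (I \<omega> = P \<omega> \<or> I \<omega> = {..<n} - P \<omega>)"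
    using inj part radon AE_space
  proof eventually_elim
    case (elim \<omega>)
    have "A \<omega> \<in> {(\<lambda>i. X i \<omega>) ` P \<omega>, (\<lambda>i. X i \<omega>) ` ({..<n} - P \<omega>)}"
      using elim(2,3) by blast
    then show ?case
      using elim(1) P(2)[of \<omega>] I_sub[OF elim(4)] by (auto simp: A inj_on_image_eq_iff)
  qed
  define E1 where "E1 = {\<omega> \<in> space M. card (I \<omega>) = k}"
  define E2 where "E2 = {\<omega> \<in> space M. card ({..<n} - I \<omega>) = k}"
  define F1 where "F1 = {\<omega> \<in> space M. card (P \<omega>) = k}"
  define F2 where "F2 = {\<omega> \<in> space M. n - card (P \<omega>) = k}"
  define C1 where "C1 = {\<omega> \<in> space M. C \<omega>}"
  define C0 where "C0 = {\<omega> \<in> space M. \<not> C \<omega>}"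
  have ev_I: "{\<omega> \<in> space M. R (I \<omega>)} \<in> events" for R
  proof -
    have "{\<omega> \<in> space M. R (I \<omega>)} = I -` {J \<in> Pow {..<n}. R J} \<inter> space M"
      using I_sub by auto
    then show ?thesis using measurable_sets[OF I, of "{J \<in> Pow {..<n}. R J}"] by auto
  qed
  have [measurable]: "E1 \<in> events" "E2 \<in> events" unfolding E1_def E2_def by (rule ev_I)+
  have [measurable]: "C1 \<in> events" "C0 \<in> events" unfolding C1_def C0_def by measurable
  have [measurable]: "F1 \<in> events" "F2 \<in> events"
    unfolding F1_def F2_def using P(1) by measurable
  \<comment> \<open>\<open>I\<close> names either part, so only the unordered pairs \<open>{E1, E2}\<close> and \<open>{F1, F2}\<close> can be compared.\<close>
  have EF_iff: "AE \<omega> in M. (\<omega> \<in> E1 \<and> \<omega> \<in> E2 \<longleftrightarrow> \<omega> \<in> F1 \<and> \<omega> \<in> F2) \<and> (\<omega> \<in> E1 \<or> \<omega> \<in> E2 \<longleftrightarrow> \<omega> \<in> F1 \<or> \<omega> \<in> F2)"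
    using parts
  proof eventually_elim
    case (elim \<omega>)
    have "{..<n} - ({..<n} - P \<omega>) = P \<omega>" using P(2)[of \<omega>] by auto
    then have "card (I \<omega>) = card (P \<omega>) \<and> card ({..<n} - I \<omega>) = n - card (P \<omega>)
        \<or> card (I \<omega>) = n - card (P \<omega>) \<and> card ({..<n} - I \<omega>) = card (P \<omega>)"
      using elim card_diff[OF P(2)[of \<omega>]] by metis
    then show ?case
      unfolding E1_def E2_def F1_def F2_def mem_Collect_eq by (elim disjE conjE) (simp_all only:, blast)
  qed
  \<comment> \<open>Inclusion and exclusion expresses the sum by union and intersection, which are
    insensitive to the order of the two events.\<close>
  have "prob E1 + prob E2 = prob (E1 \<union> E2) + prob (E1 \<inter> E2)"
    by (subst finite_measure_Union') (auto simp: finite_measure_Diff' Int_commute)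
  also have "prob (E1 \<union> E2) = prob (F1 \<union> F2)"
  proof (rule finite_measure_eq_AE)
    show "AE \<omega> in M. (\<omega> \<in> E1 \<union> E2) = (\<omega> \<in> F1 \<union> F2)"
      using EF_iff by eventually_elim simp
  qed auto
  also have "prob (E1 \<inter> E2) = prob (F1 \<inter> F2)"
  proof (rule finite_measure_eq_AE)
    show "AE \<omega> in M. (\<omega> \<in> E1 \<inter> E2) = (\<omega> \<in> F1 \<inter> F2)"
      using EF_iff by eventually_elim simp
  qed auto
  also have "prob (F1 \<union> F2) + prob (F1 \<inter> F2) = prob F1 + prob F2"
    by (subst finite_measure_Union') (auto simp: finite_measure_Diff' Int_commute)
  finally have EF: "prob E1 + prob E2 = prob F1 + prob F2" .
  \<comment> \<open>Events about \<open>I\<close> are events about the pair of points and naming,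
    from which the coin is independent.\<close>
  have ind_ev: "prob ((C -` U \<inter> space M) \<inter> {\<omega> \<in> space M. R (I \<omega>)}) = prob (C -` U \<inter> space M) * prob {\<omega> \<in> space M. R (I \<omega>)}" for U R
  proof (rule indep_setD[OF indep])
    show "C -` U \<inter> space M \<in> {C -` U \<inter> space M | U. U \<in> sets (count_space UNIV)}" by auto
    let ?V = "{p \<in> space ?N. R (snd p)}"
    have "(\<lambda>p. R (snd p)) \<in> ?N \<rightarrow>\<^sub>M count_space UNIV"
      by (rule measurable_compose[OF measurable_snd]) simp
    then have "?V \<in> sets ?N" by (rule predE)
    moreover have "{\<omega> \<in> space M. R (I \<omega>)} = ?Z -` ?V \<inter> space M"
      using measurable_space[OF Z] by auto
    ultimately show "{\<omega> \<in> space M. R (I \<omega>)} \<in> {?Z -` V \<inter> space M | V. V \<in> sets ?N}" by blast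
  qed
  have C_eq: "C1 = C -` {True} \<inter> space M" "C0 = C -` {False} \<inter> space M"
    by (auto simp: C1_def C0_def)
  have "prob C0 = 1 - prob C1"
  proof -
    have "C0 = space M - C1" by (auto simp: C1_def C0_def)
    then show ?thesis using prob_compl[of C1] by simp
  qed
  then have half': "prob C1 = 1 / 2" "prob C0 = 1 / 2" using half by (auto simp: C1_def)
  have S_ev: "{\<omega> \<in> space M. card (S \<omega>) = k} \<in> events"
  proof -
    have a: "(\<lambda>\<omega>. card ((\<lambda>i. X i \<omega>) ` I \<omega>)) \<in> M \<rightarrow>\<^sub>M count_space UNIV"
      by (rule measurable_compose_countable'[OF _ I, of "\<lambda>J \<omega>. card ((\<lambda>i. X i \<omega>) ` J)"])
        (auto intro!: measurable_card_image X countable_finite intro: finite_subset)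
    have b: "(\<lambda>\<omega>. card ((\<lambda>i. X i \<omega>) ` ({..<n} - I \<omega>))) \<in> M \<rightarrow>\<^sub>M count_space UNIV"
      by (rule measurable_compose_countable'[OF _ I, of "\<lambda>J \<omega>. card ((\<lambda>i. X i \<omega>) ` ({..<n} - J))"])
        (auto intro!: measurable_card_image X countable_finite)
    have "{\<omega> \<in> space M. if C \<omega> then card ((\<lambda>i. X i \<omega>) ` I \<omega>) = k else card ((\<lambda>i. X i \<omega>) ` ({..<n} - I \<omega>)) = k} \<in> events"
      using a b by measurable
    moreover have "card (S \<omega>) = k \<longleftrightarrow> (if C \<omega> then card ((\<lambda>i. X i \<omega>) ` I \<omega>) = k else card ((\<lambda>i. X i \<omega>) ` ({..<n} - I \<omega>)) = k)" for \<omega>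
      by (simp add: S A B)
    ultimately show ?thesis by simp
  qed
  have "prob {\<omega> \<in> space M. card (S \<omega>) = k} = prob ((C1 \<inter> E1) \<union> (C0 \<inter> E2))"
  proof (rule finite_measure_eq_AE)
    show "AE \<omega> in M. (\<omega> \<in> {\<omega> \<in> space M. card (S \<omega>) = k}) = (\<omega> \<in> (C1 \<inter> E1) \<union> (C0 \<inter> E2))"
      using parts AE_space
    proof eventually_elim
      case (elim \<omega>)
      have "card (A \<omega>) = card (I \<omega>)" "card (B \<omega>) = card ({..<n} - I \<omega>)"
        unfolding A B using elim(1) I_sub[OF elim(2)] by (auto intro!: card_image intro: inj_on_subset)
      then show ?case using elim(2) by (auto simp: S C1_def C0_def E1_def E2_def)
    qed
  qed (use S_ev in auto)
  also have "\<dots> = prob (C1 \<inter> E1) + prob (C0 \<inter> E2)"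
    by (rule finite_measure_Union) (auto simp: C1_def C0_def)
  also have "\<dots> = (prob E1 + prob E2) / 2"
    using ind_ev[of "{True}" "\<lambda>J. card J = k"] ind_ev[of "{False}" "\<lambda>J. card ({..<n} - J) = k"] half'
    unfolding C_eq[symmetric] E1_def[symmetric] E2_def[symmetric] by simp
  finally show ?thesis
    unfolding EF by (simp add: F1_def F2_def)
qed

theorem theorem1p1:
  fixes M :: "'w measure" and n :: nat and X :: "nat \<Rightarrow> 'w \<Rightarrow> real ^ 'd"
  assumes "prob_space M"
    and "n \<ge> 3" and "CARD('d) = n - 2"
    and "prob_space.indep_vars M (\<lambda>_. borel) X {..<n}"
    and "\<And>i. i < n \<Longrightarrow> distributed M lborel (X i) (\<lambda>x. ennreal (std_normal_vec_density x))"
  shows "(AE \<omega> in M. inj_on (\<lambda>i. X i \<omega>) {..<n} \<and> general_position ((\<lambda>i. X i \<omega>) ` {..<n}))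
    \<and> (AE \<omega> in M. \<exists>!Q. radon_partition ((\<lambda>i. X i \<omega>) ` {..<n}) Q)
    \<and> (\<forall>S. uniform_radon_part M n X S \<longrightarrow>
          ultra_log_concave n (\<lambda>k. measure M {\<omega> \<in> space M. card (S \<omega>) = k}))"
proof -
  interpret prob_space M by fact
  \<comment> \<open>Two added elements compensate the subtraction in \<open>n - 2\<close>, which is
    not truncated because \<open>n \<ge> 3\<close>.\<close>
  have card_n: "CARD('d option option) = n" using assms(2,3) by simp
  obtain e :: "'d option option \<Rightarrow> nat" where e: "bij_betw e UNIV {..<n}"
    using finite_same_card_bij[of "UNIV :: 'd option option set" "{..<n}"] card_n by auto
  then have inj_e: "inj e" and range_e: "range e = {..<n}" by (auto simp: bij_betw_def)
  define W where "W \<omega> = (\<chi> i. X (e i) \<omega>)" for \<omega>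
  have law: "distr M borel W = gauss" and W_meas[measurable]: "W \<in> borel_measurable M"
    using distr_points_gauss[OF assms(1,4) _ e] assms(5) unfolding W_def[abs_def] by auto
  have X_meas: "X i \<in> borel_measurable M" if "i < n" for i
    using distributed_measurable[OF assms(5)[OF that]] by simp
  have nz: "AE \<omega> in M. \<forall>i. dep (W \<omega>) $ i \<noteq> 0"
    using gauss_dep_components_nonzero[where ?'d='d] unfolding law[symmetric]
    by (rule AE_distrD[OF W_meas])
  have pts: "(\<lambda>i. X i \<omega>) ` {..<n} = range (\<lambda>i. W \<omega> $ i)" for \<omega>
    unfolding range_e[symmetric] by (auto simp: W_def)
  have inj_X: "inj_on (\<lambda>i. X i \<omega>) {..<n}" if "\<forall>i. dep (W \<omega>) $ i \<noteq> 0" for \<omega>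
  proof -
    have "inj ((\<lambda>i. X i \<omega>) \<circ> e)"
      using dep_nonzero_inj[OF that] by (simp add: W_def comp_def)
    then show ?thesis using inj_on_imageI[of "\<lambda>i. X i \<omega>" e UNIV] range_e by simp
  qed
  have 1: "AE \<omega> in M. inj_on (\<lambda>i. X i \<omega>) {..<n} \<and> general_position ((\<lambda>i. X i \<omega>) ` {..<n})"
    using nz
  proof eventually_elim
    case (elim \<omega>)
    then show ?case using inj_X dep_nonzero_general_position[OF elim] unfolding pts by blast
  qed
  have 2: "AE \<omega> in M. \<exists>!Q. radon_partition ((\<lambda>i. X i \<omega>) ` {..<n}) Q"
    using nz
  proof eventually_elim
    case (elim \<omega>)
    then show ?case unfolding pts radon_partition_dep_iff[OF elim] by simp
  qed
  have 3: "ultra_log_concave n (\<lambda>k. measure M {\<omega> \<in> space M. card (S \<omega>) = k})"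
    if S: "uniform_radon_part M n X S" for S
  proof -
    define P where "P \<omega> = e ` {i. dep (W \<omega>) $ i > 0}" for \<omega>
    have card_P: "card (P \<omega>) = card {i. dep (W \<omega>) $ i > 0}" for \<omega>
      unfolding P_def using inj_e by (intro card_image inj_on_subset[OF inj_e]) auto
    have cnt: "{w :: real ^ 'd ^ ('d option option). card {i. dep w $ i > 0} = k} \<in> sets borel"
        "{w :: real ^ 'd ^ ('d option option). card {i. dep w $ i < 0} = k} \<in> sets borel" for k
      using sets_dep_count[of 1 k] sets_dep_count[of "-1" k] by simp_all
    have P_meas: "(\<lambda>\<omega>. card (P \<omega>)) \<in> M \<rightarrow>\<^sub>M count_space UNIV"
      unfolding card_P measurable_count_space_eq2_countable
    proof (intro conjI ballI)
      fix k
      have "(\<lambda>\<omega>. card {i. dep (W \<omega>) $ i > 0}) -` {k} \<inter> space M = W -` {w. card {i. dep w $ i > 0} = k} \<inter> space M"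
        by auto
      then show "(\<lambda>\<omega>. card {i. dep (W \<omega>) $ i > 0}) -` {k} \<inter> space M \<in> events"
        using measurable_sets[OF W_meas cnt(1)] by simp
    qed simp
    \<comment> \<open>The factor \<open>2\<close> from counting both signs of \<open>dep\<close>
      cancels the \<open>1 / 2\<close> of the coin.\<close>
    have main: "prob {\<omega> \<in> space M. card (S \<omega>) = k} = real (n choose k) * sign_prob J"
      if J: "card J = k" for k and J :: "'d option option set"
    proof -
      have radon: "AE \<omega> in M. \<forall>Q. radon_partition ((\<lambda>i. X i \<omega>) ` {..<n}) Q \<longrightarrow>
          Q = {(\<lambda>i. X i \<omega>) ` P \<omega>, (\<lambda>i. X i \<omega>) ` ({..<n} - P \<omega>)}"
        using nz
      proof eventually_elim
        case (elim \<omega>)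
        have "{..<n} - P \<omega> = e ` {i. dep (W \<omega>) $ i < 0}"
          unfolding P_def range_e[symmetric] image_set_diff[OF inj_e, symmetric]
          using elim by (intro arg_cong[where f="image e"]) (auto simp: not_less less_le)
        then have "(\<lambda>i. X i \<omega>) ` P \<omega> = (\<lambda>i. W \<omega> $ i) ` {i. dep (W \<omega>) $ i > 0}"
          "(\<lambda>i. X i \<omega>) ` ({..<n} - P \<omega>) = (\<lambda>i. W \<omega> $ i) ` {i. dep (W \<omega>) $ i < 0}"
          by (simp_all add: P_def W_def image_image)
        then show ?case unfolding pts radon_partition_dep_iff[OF elim] by simp
      qed
      have Q: "AE \<omega> in M. n - card (P \<omega>) = card {i. dep (W \<omega>) $ i < 0}"
        using nz
      proof eventually_elim
        case (elim \<omega>)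
        have "- {i. dep (W \<omega>) $ i > 0} = {i. dep (W \<omega>) $ i < 0}"
          using elim by (auto simp: not_less less_le)
        then show ?case
          using card_Diff_subset[of "{i. dep (W \<omega>) $ i > 0}" UNIV] by (simp add: card_P card_n[symmetric] Compl_eq_Diff_UNIV)
      qed
      have "prob {\<omega> \<in> space M. card (P \<omega>) = k} = prob (W -` {w. card {i. dep w $ i > 0} = k} \<inter> space M)"
        by (intro arg_cong[where f=prob]) (auto simp: card_P)
      moreover have "prob {\<omega> \<in> space M. n - card (P \<omega>) = k} = prob (W -` {w. card {i. dep w $ i < 0} = k} \<inter> space M)"
      proof (rule finite_measure_eq_AE)
        show "AE \<omega> in M. (\<omega> \<in> {\<omega> \<in> space M. n - card (P \<omega>) = k}) = (\<omega> \<in> W -` {w. card {i. dep w $ i < 0} = k} \<inter> space M)"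
          using Q by eventually_elim auto
        show "{\<omega> \<in> space M. n - card (P \<omega>) = k} \<in> events" using P_meas by measurable
      qed (rule measurable_sets[OF W_meas cnt(2)])
      moreover have "prob (W -` {w. card {i. dep w $ i > 0} = k} \<inter> space M) + prob (W -` {w. card {i. dep w $ i < 0} = k} \<inter> space M)
          = 2 * real (n choose k) * sign_prob J"
        using dep_sign_count[OF J] cnt unfolding card_n law[symmetric] by (simp add: measure_distr)
      moreover have "AE \<omega> in M. inj_on (\<lambda>i. X i \<omega>) {..<n}" using 1 by eventually_elim simp
      moreover have "P \<omega> \<subseteq> {..<n}" for \<omega> unfolding P_def range_e[symmetric] by auto
      ultimately show ?thesis
        using prob_card_uniform_radon_part[OF assms(1) S X_meas _ P_meas _ radon, of k] by simp
    qed
    show ?thesis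
      unfolding ultra_log_concave_def
    proof
      fix k assume k: "k \<in> {1..n - 1}"
      have sub: "\<exists>J :: 'd option option set. card J = l" if "l \<le> n" for l
        using obtain_subset_with_card_n[of l "UNIV :: 'd option option set"] card_n that by metis
      have le: "k - 1 \<le> n" "k \<le> n" "k + 1 \<le> n" using k assms(2) by auto
      obtain J0 J1 J2 :: "'d option option set" where J: "card J0 = k - 1" "card J1 = k" "card J2 = k + 1"
        using sub[OF le(1)] sub[OF le(2)] sub[OF le(3)] by blast
      \<comment> \<open>For \<open>l \<le> n\<close> the binomial coefficient is nonzero, so
        division leaves the probability of a single sign pattern.\<close>
      have quot: "prob {\<omega> \<in> space M. card (S \<omega>) = l} / real (n choose l) = sign_prob J"
        if "card J = l" "l \<le> n" for l and J :: "'d option option set"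
        using main[OF that(1)] that(2) by simp
      have "sign_prob J2 * sign_prob J0 \<le> (sign_prob J1)\<^sup>2"
        using J k card_n assms(2) by (intro sign_prob_log_concave) auto
      then show "(prob {\<omega> \<in> space M. card (S \<omega>) = k} / real (n choose k))\<^sup>2
          \<ge> (prob {\<omega> \<in> space M. card (S \<omega>) = k + 1} / real (n choose (k + 1))) *
            (prob {\<omega> \<in> space M. card (S \<omega>) = k - 1} / real (n choose (k - 1)))"
        unfolding quot[OF J(1) le(1)] quot[OF J(2) le(2)] quot[OF J(3) le(3)] .
    qed
  qed
  show ?thesis using 1 2 3 by blast
qed

end
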